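(* The condition $wt(\omega)+wt(d\eta)\le\nu_1$ in the following statement is sharp (meaning that the conclusion fails if the condition is violated): "Let $G_1$ and $G_2$ be Carnot groups, where $G_1$ has topological dimension $N$ and homogeneous dimension $\nu_1$, and $G_2$ has step $n$. Suppose $f\in W^{1,p}(U;G_2)$ and $f:U\to U'\subset G_2$, where $U$ is an open domain in $G_1$; let $\omega\in\Omega^k(U')$ be a continuous closed form and $\eta\in\Omega_c^{N-k-1}(U)$ a smooth compactly supported form. When $p>\max\{wt(\omega),n+1\}$ and $wt(\omega)+wt(d\eta)\le\nu_1$, then $\int_Uf_P^*\omega\wedge d\eta=0$."
   Context: A Carnot group is a simply connected nilpotent Lie group $G$ whose Lie algebra is stratified, $\mathfrak g=\mathfrak g^{[1]}\oplus\cdots\oplus\mathfrak g^{[s]}$ with $[\mathfrak g^{[1]},\mathfrak g^{[k]}]=\mathfrak g^{[k+1]}$ ($\mathfrak g^{[k]}=0$ for $k>s$; $s$ is the step), with an inner product on $\mathfrak g$ making the layers orthogonal. It carries the left-invariant sub-Riemannian (Carnot–Carathéodory) distance $d$ and dilations $\delta_\lambda$ acting on $\mathfrak g^{[k]}$ by $\lambda^k$. The homogeneous dimension is $\sum_k k\dim\mathfrak g^{[k]}$. $f\in W^{1,p}(U;G_2)$ is understood in the usual metric sense: for $z\in G_2$ the function $x\mapsto d(z,f(x))$ is in $L^p_{loc}(U)$ with weak horizontal gradient bounded a.e. by one function $g\in L^p(U)$ independent of $z$. Pansu pullback: $f$ is taken to be Pansu differentiable almost everywhere, i.e. for a.e.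 $x$ the maps $y\mapsto\delta_{1/r}\big(f(x)^{-1}f(x\,\delta_r y)\big)$ converge as $r\to0$ to a homogeneous homomorphism $G_1\to G_2$, inducing a graded Lie algebra homomorphism $D_Pf(x):\mathfrak g_1\to\mathfrak g_2$. Identifying tangent spaces with the Lie algebras by left translation, $(f_P^*\omega)(x)=(D_Pf(x))^*\omega(f(x))$. Weights ($wt$) are counted positively: a left-invariant one-form dual to the $i$-th layer (vanishing on all other layers) has weight $i$; a wedge product of such forms has the sum of the weights; the weight of a nonzero alternating form on $\mathfrak g$ is the largest weight occurring among its nonzero components in the weight decomposition. For a differential form $\alpha$ not vanishing a.e., $wt(\alpha)$ is the essential supremum of $wt(\alpha(x))$ over $\{x:\alpha(x)\ne0\}$. A continuous form is closed if its exterior derivative vanishes in the distributional sense. *)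

theory Defs
  imports
    "HOL-Analysis.Analysis"
    "HOL-Algebra.Group"
    "HOL-Combinatorics.Permutations"
    "HOL-Combinatorics.List_Permutation"
begin

section \<open>Coordinate space of variable dimension\<close>

text \<open>
  Dimensions must be bound variables, so points of \<open>N\<close>-space are extensional functions
  on \<open>{..<N}\<close>; this is the carrier of both the topology \<open>powertop_real {..<N}\<close> and the
  product measure of \<open>N\<close> copies of \<open>lborel\<close>.
\<close>

type_synonym pt = "nat \<Rightarrow> real"

abbreviation space_n :: "nat \<Rightarrow> pt set" where
  "space_n N \<equiv> ({..<N} \<rightarrow>\<^sub>E UNIV)"

abbreviation top_n :: "nat \<Rightarrow> pt topology" where
  "top_n N \<equiv> powertop_real {..<N}"

definition leb_n :: "nat \<Rightarrow> pt measure" where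
  "leb_n N = completion (Pi\<^sub>M {..<N} (\<lambda>_. lborel))"

definition lincomb :: "nat \<Rightarrow> real \<Rightarrow> pt \<Rightarrow> real \<Rightarrow> pt \<Rightarrow> pt" where
  "lincomb N a u b v = (\<lambda>i\<in>{..<N}. a * u i + b * v i)"

definition scale :: "nat \<Rightarrow> real \<Rightarrow> pt \<Rightarrow> pt" where
  "scale N a u = (\<lambda>i\<in>{..<N}. a * u i)"

definition unit_vec :: "nat \<Rightarrow> nat \<Rightarrow> pt" where
  "unit_vec N i = (\<lambda>j\<in>{..<N}. if j = i then 1 else 0)"

definition partial :: "nat \<Rightarrow> (pt \<Rightarrow> real) \<Rightarrow> pt \<Rightarrow> real" where
  "partial i h x = deriv (\<lambda>t. h (x(i := t))) (x i)"

text \<open>\<open>C\<^sup>\<infinity>\<close> on an open set: all iterated partial derivatives exist and are continuous.\<close>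

definition smooth_on :: "nat \<Rightarrow> pt set \<Rightarrow> (pt \<Rightarrow> real) \<Rightarrow> bool" where
  "smooth_on N U h \<longleftrightarrow>
    (\<forall>js\<in>lists {..<N}.
       continuous_map (subtopology (top_n N) U) euclideanreal (foldr partial js h) \<and>
       (\<forall>x\<in>U. \<forall>i<N. (\<lambda>t. foldr partial js h (x(i := t))) field_differentiable at (x i)))"

definition open_domain :: "nat \<Rightarrow> pt set \<Rightarrow> bool" where
  "open_domain N U \<longleftrightarrow> openin (top_n N) U \<and> connectedin (top_n N) U \<and> U \<noteq> {}"


section \<open>Carnot groups\<close>

text \<open>
  A simply connected nilpotent Lie group is represented on its Lie algebra by the exponential map
  (exponential coordinates of the first kind), and the Lie algebra is identified with
  \<open>N\<close>-space by an orthonormal basis adapted to the orthogonal stratification; \<open>layer i\<close> is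
  the index of the layer that contains the \<open>i\<close>-th basis vector. Hence the exponential map is the
  identity, and every Carnot group whose inner product makes the layers orthogonal has such a presentation.
\<close>

record carnot = "pt monoid" +
  gdim :: nat
  layer :: "nat \<Rightarrow> nat"

text \<open>
  The Lie bracket of left-invariant vector fields at the identity (the zero vector):
  with \<open>X\<^sub>u h(x) = d/dt h(x exp(tu))\<close> at \<open>t = 0\<close>, one has
  \<open>(X\<^sub>u X\<^sub>v - X\<^sub>v X\<^sub>u) h(0) = d/ds d/dt [h(exp(su) exp(tv)) - h(exp(tv) exp(su))]\<close> at
  \<open>s = t = 0\<close>.
\<close>

definition bracket :: "carnot \<Rightarrow> pt \<Rightarrow> pt \<Rightarrow> pt" where
  "bracket G u v = (\<lambda>i\<in>{..<gdim G}.
     deriv (\<lambda>s. deriv (\<lambda>t. (scale (gdim G) s u \<otimes>\<^bsub>G\<^esub> scale (gdim G) t v) i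
                          - (scale (gdim G) t v \<otimes>\<^bsub>G\<^esub> scale (gdim G) s u) i) 0) 0)"

definition layer_space :: "carnot \<Rightarrow> nat \<Rightarrow> pt set" where
  "layer_space G k = {v \<in> space_n (gdim G). \<forall>i<gdim G. layer G i \<noteq> k \<longrightarrow> v i = 0}"

text \<open>The linear span of all brackets; scalar factors are absorbed into the vectors of \<open>V\<close>.\<close>

definition bracket_span :: "carnot \<Rightarrow> pt set \<Rightarrow> pt set \<Rightarrow> pt set" where
  "bracket_span G V W =
     {(\<lambda>i\<in>{..<gdim G}. \<Sum>r<m. bracket G (u r) (v r) i) | (m :: nat) u v.
        \<forall>r<m. u r \<in> V \<and> v r \<in> W}"

text \<open>
  Joint smoothness of the product is smoothness on \<open>2N\<close>-space. The one-parameter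
  subgroup condition says that the exponential map is the identity, so the neutral element is the
  zero vector and inversion is negation.
\<close>

locale carnot_group = group G for G :: carnot (structure) +
  assumes carrier_eq: "carrier G = space_n (gdim G)"
    and mult_smooth: "k < gdim G \<Longrightarrow>
      smooth_on (2 * gdim G) (space_n (2 * gdim G))
        (\<lambda>z. ((\<lambda>i\<in>{..<gdim G}. z i) \<otimes> (\<lambda>i\<in>{..<gdim G}. z (gdim G + i))) k)"
    and one_parameter: "x \<in> carrier G \<Longrightarrow>
      scale (gdim G) s x \<otimes> scale (gdim G) t x = scale (gdim G) (s + t) x"
    and layer_pos: "i < gdim G \<Longrightarrow> 1 \<le> layer G i"
    and stratified: "1 \<le> k \<Longrightarrow>
      bracket_span G (layer_space G 1) (layer_space G k) = layer_space G (Suc k)"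

definition step :: "carnot \<Rightarrow> nat" where
  "step G = (LEAST s. \<forall>i<gdim G. layer G i \<le> s)"

definition hom_dim :: "carnot \<Rightarrow> nat" where
  "hom_dim G = (\<Sum>k = 1..step G. k * card {i. i < gdim G \<and> layer G i = k})"

definition dilation :: "carnot \<Rightarrow> real \<Rightarrow> pt \<Rightarrow> pt" where
  "dilation G r x = (\<lambda>i\<in>{..<gdim G}. r ^ layer G i * x i)"

text \<open>Derivative of \<open>h\<close> at \<open>x\<close> along the left-invariant vector field with value \<open>v\<close> at the identity.\<close>

definition lderiv :: "carnot \<Rightarrow> pt \<Rightarrow> (pt \<Rightarrow> real) \<Rightarrow> pt \<Rightarrow> real" where
  "lderiv G v h x = deriv (\<lambda>t. h (x \<otimes>\<^bsub>G\<^esub> scale (gdim G) t v)) 0"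

definition horizontal_indices :: "carnot \<Rightarrow> nat set" where
  "horizontal_indices G = {j. j < gdim G \<and> layer G j = 1}"

text \<open>
  An absolutely continuous curve \<open>\<gamma>\<close> on \<open>[0,T]\<close> with horizontal velocity
  \<open>\<Sum>\<^sub>j u\<^sub>j X\<^sub>j(\<gamma>)\<close> a.e., in integrated form; \<open>X\<^sub>j\<close> are the left-invariant fields of
  the orthonormal basis of the first layer.
\<close>

definition horizontal_curve :: "carnot \<Rightarrow> real \<Rightarrow> (nat \<Rightarrow> real \<Rightarrow> real) \<Rightarrow> (real \<Rightarrow> pt) \<Rightarrow> bool" where
  "horizontal_curve G T u \<gamma> \<longleftrightarrow>
     0 \<le> T \<and>
     (\<forall>j\<in>horizontal_indices G. u j absolutely_integrable_on {0..T}) \<and>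
     (\<forall>t\<in>{0..T}. \<gamma> t \<in> carrier G \<and>
        (\<forall>i<gdim G.
           ((\<lambda>s. \<Sum>j\<in>horizontal_indices G.
                  u j s * lderiv G (unit_vec (gdim G) j) (\<lambda>y. y i) (\<gamma> s))
             has_integral (\<gamma> t i - \<gamma> 0 i)) {0..t}))"

text \<open>By the Chow--Rashevskii theorem the infimum is over a nonempty set.\<close>

definition cc_dist :: "carnot \<Rightarrow> pt \<Rightarrow> pt \<Rightarrow> real" where
  "cc_dist G a b = Inf {integral {0..T} (\<lambda>t. sqrt (\<Sum>j\<in>horizontal_indices G. (u j t)\<^sup>2)) | T u \<gamma>.
     horizontal_curve G T u \<gamma> \<and> \<gamma> 0 = a \<and> \<gamma> T = b}"


section \<open>Differential forms\<close>

text \<open>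
  Tangent spaces are identified with the Lie algebra by left translation: a \<open>k\<close>-form assigns to
  each point an alternating \<open>k\<close>-linear function on the Lie algebra, given as a function on
  lists of length \<open>k\<close> (values on other lists are irrelevant).
\<close>

type_synonym covector = "pt list \<Rightarrow> real"

definition vlists :: "nat \<Rightarrow> nat \<Rightarrow> pt list set" where
  "vlists N k = {vs. set vs \<subseteq> space_n N \<and> length vs = k}"

definition alternating_form :: "nat \<Rightarrow> nat \<Rightarrow> covector \<Rightarrow> bool" where
  "alternating_form N k a \<longleftrightarrow>
     (\<forall>vs\<in>vlists N k. \<forall>i<k. \<forall>u\<in>space_n N. \<forall>v\<in>space_n N. \<forall>c d.
        a (vs[i := lincomb N c u d v]) = c * a (vs[i := u]) + d * a (vs[i := v])) \<and>
     (\<forall>vs\<in>vlists N k. \<not> distinct vs \<longrightarrow> a vs = 0)"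

definition wedge :: "nat \<Rightarrow> nat \<Rightarrow> covector \<Rightarrow> covector \<Rightarrow> covector" where
  "wedge k l a b vs =
     (\<Sum>\<sigma> | \<sigma> permutes {..<k + l}.
        of_int (sign \<sigma>) * a (take k (permute_list \<sigma> vs)) * b (drop k (permute_list \<sigma> vs)))
     / (fact k * fact l)"

definition continuous_form :: "carnot \<Rightarrow> pt set \<Rightarrow> nat \<Rightarrow> (pt \<Rightarrow> covector) \<Rightarrow> bool" where
  "continuous_form G U k \<alpha> \<longleftrightarrow>
     (\<forall>x\<in>U. alternating_form (gdim G) k (\<alpha> x)) \<and>
     (\<forall>vs\<in>vlists (gdim G) k.
        continuous_map (subtopology (top_n (gdim G)) U) euclideanreal (\<lambda>x. \<alpha> x vs))"

definition smooth_form :: "carnot \<Rightarrow> pt set \<Rightarrow> nat \<Rightarrow> (pt \<Rightarrow> covector) \<Rightarrow> bool" where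
  "smooth_form G U k \<alpha> \<longleftrightarrow>
     (\<forall>x\<in>U. alternating_form (gdim G) k (\<alpha> x)) \<and>
     (\<forall>vs\<in>vlists (gdim G) k. smooth_on (gdim G) U (\<lambda>x. \<alpha> x vs))"

definition compactly_supported_form :: "carnot \<Rightarrow> pt set \<Rightarrow> nat \<Rightarrow> (pt \<Rightarrow> covector) \<Rightarrow> bool" where
  "compactly_supported_form G U k \<alpha> \<longleftrightarrow>
     (\<exists>K. compactin (top_n (gdim G)) K \<and> K \<subseteq> U \<and>
          (\<forall>x\<in>U - K. \<forall>vs\<in>vlists (gdim G) k. \<alpha> x vs = 0))"

text \<open>
  The invariant formula for the exterior derivative of a \<open>k\<close>-form, evaluated on the
  left-invariant fields that extend \<open>vs\<close> (a list of length \<open>k + 1\<close>).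
\<close>

definition ext_deriv :: "carnot \<Rightarrow> nat \<Rightarrow> (pt \<Rightarrow> covector) \<Rightarrow> pt \<Rightarrow> covector" where
  "ext_deriv G k \<alpha> x vs =
     (\<Sum>i\<le>k. (-1) ^ i * lderiv G (vs ! i) (\<lambda>y. \<alpha> y (nths vs (- {i}))) x) +
     (\<Sum>j\<le>k. \<Sum>i<j. (-1) ^ (i + j) * \<alpha> x (bracket G (vs ! i) (vs ! j) # nths vs (- {i, j})))"

text \<open>
  Integral of an \<open>N\<close>-form. In exponential coordinates left translations are unipotent, so the
  left-invariant coframe satisfies \<open>\<theta>\<^sub>1 \<and> \<dots> \<and> \<theta>\<^sub>N = dx\<^sub>1 \<and> \<dots> \<and> dx\<^sub>N\<close>.
\<close>

definition form_integral :: "carnot \<Rightarrow> pt set \<Rightarrow> (pt \<Rightarrow> covector) \<Rightarrow> real" where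
  "form_integral G U \<beta> =
     (LINT x:U|leb_n (gdim G). \<beta> x (map (unit_vec (gdim G)) [0..<gdim G]))"

text \<open>Vanishing of the exterior derivative in the sense of distributions.\<close>

definition closed_form :: "carnot \<Rightarrow> pt set \<Rightarrow> nat \<Rightarrow> (pt \<Rightarrow> covector) \<Rightarrow> bool" where
  "closed_form G U k \<omega> \<longleftrightarrow>
     (\<forall>l \<phi>. k + l + 1 = gdim G \<and> smooth_form G U l \<phi> \<and> compactly_supported_form G U l \<phi> \<longrightarrow>
        form_integral G U (\<lambda>x. wedge k (l + 1) (\<omega> x) (ext_deriv G l \<phi> x)) = 0)"


section \<open>Weights\<close>

text \<open>
  The dual basis monomial \<open>\<theta>\<^sub>i\<^sub>1 \<and> \<dots> \<and> \<theta>\<^sub>i\<^sub>k\<close> has weight \<open>\<Sum> layer i\<^sub>r\<close>, and its coefficient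
  in \<open>a\<close> is the value of \<open>a\<close> on the corresponding basis vectors.
\<close>

definition component_weights :: "carnot \<Rightarrow> nat \<Rightarrow> covector \<Rightarrow> nat set" where
  "component_weights G k a =
     {sum_list (map (layer G) js) | js.
        set js \<subseteq> {..<gdim G} \<and> length js = k \<and> a (map (unit_vec (gdim G)) js) \<noteq> 0}"

definition covector_wt :: "carnot \<Rightarrow> nat \<Rightarrow> covector \<Rightarrow> nat" where
  "covector_wt G k a = Max (component_weights G k a)"

text \<open>
  Essential supremum of the weight over the points where the form is nonzero; the value for a form
  that vanishes a.e., for which no weight is defined, is the dummy \<open>0\<close>.
\<close>

definition form_wt :: "carnot \<Rightarrow> pt set \<Rightarrow> nat \<Rightarrow> (pt \<Rightarrow> covector) \<Rightarrow> nat" where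
  "form_wt G U k \<alpha> =
     (LEAST m. AE x in leb_n (gdim G).
        x \<in> U \<and> (\<exists>vs\<in>vlists (gdim G) k. \<alpha> x vs \<noteq> 0) \<longrightarrow> covector_wt G k (\<alpha> x) \<le> m)"


section \<open>Sobolev maps and the Pansu pullback\<close>

definition Lp_on :: "nat \<Rightarrow> real \<Rightarrow> pt set \<Rightarrow> (pt \<Rightarrow> real) \<Rightarrow> bool" where
  "Lp_on N p A h \<longleftrightarrow>
     set_borel_measurable (leb_n N) A h \<and> set_integrable (leb_n N) A (\<lambda>x. \<bar>h x\<bar> powr p)"

definition Lp_loc :: "nat \<Rightarrow> real \<Rightarrow> pt set \<Rightarrow> (pt \<Rightarrow> real) \<Rightarrow> bool" where
  "Lp_loc N p U h \<longleftrightarrow> (\<forall>K. compactin (top_n N) K \<and> K \<subseteq> U \<longrightarrow> Lp_on N p K h)"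

definition test_function :: "nat \<Rightarrow> pt set \<Rightarrow> (pt \<Rightarrow> real) \<Rightarrow> bool" where
  "test_function N U \<phi> \<longleftrightarrow> smooth_on N U \<phi> \<and>
     (\<exists>K. compactin (top_n N) K \<and> K \<subseteq> U \<and> (\<forall>x\<in>U - K. \<phi> x = 0))"

text \<open>No zeroth-order term appears because left-invariant fields are divergence free.\<close>

definition weak_lderiv :: "carnot \<Rightarrow> pt set \<Rightarrow> nat \<Rightarrow> (pt \<Rightarrow> real) \<Rightarrow> (pt \<Rightarrow> real) \<Rightarrow> bool" where
  "weak_lderiv G U j u h \<longleftrightarrow> Lp_loc (gdim G) 1 U h \<and>
     (\<forall>\<phi>. test_function (gdim G) U \<phi> \<longrightarrow>
        (LINT x:U|leb_n (gdim G). u x * lderiv G (unit_vec (gdim G) j) \<phi> x)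
        = - (LINT x:U|leb_n (gdim G). h x * \<phi> x))"

definition sobolev_map :: "real \<Rightarrow> carnot \<Rightarrow> pt set \<Rightarrow> carnot \<Rightarrow> (pt \<Rightarrow> pt) \<Rightarrow> bool" where
  "sobolev_map p G U H f \<longleftrightarrow>
     (\<forall>x\<in>U. f x \<in> carrier H) \<and>
     (\<exists>g. Lp_on (gdim G) p U g \<and>
       (\<forall>z\<in>carrier H.
          Lp_loc (gdim G) p U (\<lambda>x. cc_dist H z (f x)) \<and>
          (\<exists>D. (\<forall>j\<in>horizontal_indices G. weak_lderiv G U j (\<lambda>x. cc_dist H z (f x)) (D j)) \<and>
               (AE x in leb_n (gdim G).
                  x \<in> U \<longrightarrow> sqrt (\<Sum>j\<in>horizontal_indices G. (D j x)\<^sup>2) \<le> g x))))"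

text \<open>
  Uniform convergence on compact sets of the Pansu difference quotients. As the exponential maps are
  identities in the chosen coordinates, the limit homomorphism \<open>L\<close> coincides with the graded Lie
  algebra homomorphism it induces.
\<close>

definition has_pansu_derivative :: "carnot \<Rightarrow> carnot \<Rightarrow> (pt \<Rightarrow> pt) \<Rightarrow> (pt \<Rightarrow> pt) \<Rightarrow> pt \<Rightarrow> bool" where
  "has_pansu_derivative G H f L x \<longleftrightarrow>
     L \<in> hom G H \<and>
     (\<forall>r>0. \<forall>y\<in>carrier G. L (dilation G r y) = dilation H r (L y)) \<and>
     (\<forall>K. compactin (top_n (gdim G)) K \<longrightarrow>
        (\<forall>i<gdim H.
           uniform_limit K
             (\<lambda>r y. dilation H (1 / r) (inv\<^bsub>H\<^esub> (f x) \<otimes>\<^bsub>H\<^esub> f (x \<otimes>\<^bsub>G\<^esub> dilation G r y)) i)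
             (\<lambda>y. L y i) (at_right 0)))"

definition pansu_differentiable_ae :: "carnot \<Rightarrow> pt set \<Rightarrow> carnot \<Rightarrow> (pt \<Rightarrow> pt) \<Rightarrow> bool" where
  "pansu_differentiable_ae G U H f \<longleftrightarrow>
     (AE x in leb_n (gdim G). x \<in> U \<longrightarrow> (\<exists>L. has_pansu_derivative G H f L x))"

definition pansu_derivative :: "carnot \<Rightarrow> carnot \<Rightarrow> (pt \<Rightarrow> pt) \<Rightarrow> pt \<Rightarrow> pt \<Rightarrow> pt" where
  "pansu_derivative G H f x = (SOME L. has_pansu_derivative G H f L x)"

definition pansu_pullback :: "carnot \<Rightarrow> carnot \<Rightarrow> (pt \<Rightarrow> pt) \<Rightarrow> (pt \<Rightarrow> covector) \<Rightarrow> pt \<Rightarrow> covector" where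
  "pansu_pullback G H f \<omega> x vs = \<omega> (f x) (map (pansu_derivative G H f x) vs)"

end

theory Submission
  imports Defs
begin

text \<open>
  A Pansu pullback is not a pullback: \<open>f\<^sub>P\<^sup>*\<omega>\<close> retains only the part of \<open>f\<^sup>*\<omega>\<close> in which
  \<open>f\<close> respects the grading. When a discarded part of \<open>f\<^sup>*\<omega>\<close> can be paired with \<open>d\<eta>\<close>,
  Stokes' theorem breaks down. The smallest instance takes both groups to be the Heisenberg group
  \<open>H\<close>, with left-invariant fields \<open>X, Y, T = [X,Y]\<close>, dual coframe \<open>dx\<^sub>0, dx\<^sub>1, \<theta>\<close> and
  homogeneous dimension \<open>4\<close>.

  The map is \<open>f(x) = exp(x\<^sub>2 X)\<close>: it wraps the vertical coordinate along a horizontal line. The form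
  is \<open>\<omega> = d(x\<^sub>0 + x\<^sub>2)\<close>, which is exact. On the image line \<open>f\<^sup>*\<omega> = dx\<^sub>2\<close>, but the Pansu
  derivative of \<open>f\<close> kills \<open>T\<close>, so that \<open>f\<^sub>P\<^sup>*\<omega> = dx\<^sub>2 - \<theta>\<close>, the horizontal part of
  \<open>dx\<^sub>2\<close>. With \<open>\<eta> = h\<theta>\<close> for a bump function \<open>h\<close> and \<open>d\<theta> = - dx\<^sub>0 \<and> dx\<^sub>1\<close> this gives
  \<open>\<integral> f\<^sub>P\<^sup>*\<omega> \<and> d\<eta> = - \<integral> \<theta> \<and> d\<eta> = \<integral> h > 0\<close>, computed in
  \<open>form_integral_integrand\<close>.

  The weight condition fails because \<open>\<omega>\<close> has the vertical component \<open>\<theta>\<close> of weight \<open>2\<close>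
  (\<open>form_wt_omega\<close>), although \<open>f\<^sub>P\<^sup>*\<close> sees only the component of weight \<open>1\<close>, and because
  \<open>dh \<and> \<theta>\<close> has weight \<open>3\<close> (\<open>form_wt_d_eta\<close>): the sum \<open>5\<close> exceeds \<open>4\<close>. Only lower bounds on
  weights are needed, since \<open>f\<close> lies in every Sobolev space over a bounded domain and \<open>p\<close> can be
  taken as large as desired.

  The analytic work is in the hypotheses on \<open>f\<close> and \<open>\<omega>\<close>. For the Sobolev condition
  (\<open>sobolev_height_map\<close>) one needs that \<open>D(t) = d(z, exp(tX))\<close> has a bounded weak derivative
  for every \<open>z\<close>: it is \<open>1\<close>-Lipschitz, because a horizontal path that ends at \<open>exp(sX)\<close> can be
  prolonged along the line (\<open>cc_dist_xline_Lipschitz\<close>), and Lipschitz functions have bounded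
  densities by the Radon--Nikodym theorem (\<open>Lipschitz_has_density\<close>). The weak derivatives of
  \<open>D(x\<^sub>2)\<close>, the closedness of \<open>\<omega>\<close> and the value of the final integral all reduce to
  integration by parts in one coordinate (\<open>integration_by_parts_coord\<close>).
\<close>

section \<open>Lipschitz functions of one variable and integration by parts\<close>

text \<open>
  Lipschitz with derivative \<open>h\<close> almost everywhere, expressed through increments because this
  derivative is only ever used under an integral.
\<close>

definition has_density :: "(real \<Rightarrow> real) \<Rightarrow> (real \<Rightarrow> real) \<Rightarrow> bool" where
  "has_density D h \<longleftrightarrow> h \<in> borel_measurable borel \<and> (\<exists>C. \<forall>t. \<bar>h t\<bar> \<le> C) \<and>
     (\<forall>a b. a \<le> b \<longrightarrow> D b - D a = (LINT s:{a..b}|lborel. h s))"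

lemma integrable_bounded_on_finite:
  fixes f :: "'a \<Rightarrow> real"
  assumes "f \<in> borel_measurable M" "A \<in> sets M" "emeasure M A < \<infinity>"
    and "\<And>x. x \<in> space M \<Longrightarrow> \<bar>f x\<bar> \<le> C" "\<And>x. x \<in> space M \<Longrightarrow> x \<notin> A \<Longrightarrow> f x = 0"
  shows "integrable M f"
proof (rule Bochner_Integration.integrable_bound)
  show "integrable M (\<lambda>x. C * indicator A x)"
    using assms(2,3) by (intro integrable_mult_right integrable_real_indicator)
  show "AE x in M. norm (f x) \<le> norm (C * indicator A x)"
  proof (rule AE_I2)
    fix x assume "x \<in> space M"
    then show "norm (f x) \<le> norm (C * indicator A x)"
      using assms(4,5)[of x] by (cases "x \<in> A") auto
  qed
qed (fact assms(1))

lemma has_density_Lipschitz: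
  assumes "has_density D h"
  shows "\<exists>C\<ge>0. (\<forall>t. \<bar>h t\<bar> \<le> C) \<and> (\<forall>a b. \<bar>D b - D a\<bar> \<le> C * \<bar>b - a\<bar>)"
proof -
  obtain C where C: "\<And>t. \<bar>h t\<bar> \<le> C" and hm[measurable]: "h \<in> borel_measurable borel"
    and D: "\<And>a b. a \<le> b \<Longrightarrow> D b - D a = (LINT s:{a..b}|lborel. h s)"
    using assms unfolding has_density_def by blast
  have *: "\<bar>D b - D a\<bar> \<le> C * \<bar>b - a\<bar>" if "a \<le> b" for a b
  proof -
    have i: "set_integrable lborel {a..b} h"
      unfolding set_integrable_def
      by (rule integrable_bounded_on_finite[where A="{a..b}" and C=C])
        (use C order_trans[OF abs_ge_zero C] in \<open>auto simp: indicator_def emeasure_lborel_Icc_eq\<close>)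
    have "\<bar>LINT s:{a..b}|lborel. h s\<bar> \<le> (LINT s:{a..b}|lborel. \<bar>h s\<bar>)"
      using set_integral_norm_bound[OF i] by simp
    also have "\<dots> \<le> (LINT s:{a..b}|lborel. C)"
      using i C by (intro set_integral_mono)
        (auto simp: set_integrable_abs set_integrable_def[of _ _ "\<lambda>_. C"] emeasure_lborel_Icc_eq)
    also have "\<dots> = C * (b - a)"
      using that by (simp add: set_integral_const)
    finally show ?thesis using D[OF that] that by simp
  qed
  have "\<bar>D b - D a\<bar> \<le> C * \<bar>b - a\<bar>" for a b
    using *[of a b] *[of b a] by (metis abs_minus_commute linear)
  moreover have "C \<ge> 0" using C[of 0] by linarith
  ultimately show ?thesis using C by blast
qed

lemma has_density_measurable:
  assumes "has_density D h" shows "D \<in> borel_measurable borel"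
proof -
  obtain C where C: "C \<ge> 0" "\<And>t. \<bar>h t\<bar> \<le> C" "\<And>a b. \<bar>D b - D a\<bar> \<le> C * \<bar>b - a\<bar>"
    using has_density_Lipschitz[OF assms] by auto
  have "C-lipschitz_on UNIV D"
    using C by (intro lipschitz_onI) (auto simp: dist_real_def)
  then have "continuous_on UNIV D" by (rule lipschitz_on_continuous_on)
  then show ?thesis by (rule borel_measurable_continuous_onI)
qed

lemma integral_deriv_eq:
  fixes \<psi> :: "real \<Rightarrow> real"
  assumes d: "\<And>t. (\<psi> has_real_derivative \<psi>' t) (at t)"
    and m[measurable]: "\<psi>' \<in> borel_measurable borel" and B: "\<And>t. \<bar>\<psi>' t\<bar> \<le> B" and ab: "a \<le> b"
  shows "(LINT t:{a..b}|lborel. \<psi>' t) = \<psi> b - \<psi> a"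
proof -
  have i: "set_integrable lborel {a..b} \<psi>'"
    unfolding set_integrable_def
    by (rule integrable_bounded_on_finite[where A="{a..b}" and C=B])
      (use B order_trans[OF abs_ge_zero B] in \<open>auto simp: indicator_def emeasure_lborel_Icc_eq\<close>)
  have "(\<psi>' has_integral (\<psi> b - \<psi> a)) {a..b}"
    using d ab by (intro fundamental_theorem_of_calculus)
      (auto simp: has_real_derivative_iff_has_vector_derivative[symmetric] intro: has_field_derivative_at_within)
  moreover have "(\<psi>' has_integral (LINT t:{a..b}|lborel. \<psi>' t)) {a..b}"
    using set_borel_integral_eq_integral[OF i] by (simp add: has_integral_iff)
  ultimately show ?thesis by (rule has_integral_unique[symmetric])
qed

text \<open>
  Insert \<open>D t = D (-r) + \<integral>\<^bsub>-r\<^esub>\<^bsup>t\<^esup> h\<close> and exchange the two integrals by Fubini; the inner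
  integral of \<open>\<psi>'\<close> over \<open>[s,r]\<close> is \<open>- \<psi> s\<close> because \<open>\<psi>\<close> vanishes at \<open>r\<close>.
\<close>

lemma integration_by_parts_density:
  fixes \<psi> :: "real \<Rightarrow> real"
  assumes D: "has_density D h"
    and d: "\<And>t. (\<psi> has_real_derivative \<psi>' t) (at t)"
    and m[measurable]: "\<psi>' \<in> borel_measurable borel" and B: "\<And>t. \<bar>\<psi>' t\<bar> \<le> B"
    and R: "\<And>t. \<bar>t\<bar> > R \<Longrightarrow> \<psi> t = 0" "\<And>t. \<bar>t\<bar> > R \<Longrightarrow> \<psi>' t = 0"
  shows "(\<integral>t. D t * \<psi>' t \<partial>lborel) = - (\<integral>t. h t * \<psi> t \<partial>lborel)"
proof -
  have hm[measurable]: "h \<in> borel_measurable borel"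
    and Dh: "\<And>a b. a \<le> b \<Longrightarrow> D b - D a = (LINT s:{a..b}|lborel. h s)"
    using D unfolding has_density_def by blast+
  obtain C where C: "C \<ge> 0" "\<And>t. \<bar>h t\<bar> \<le> C" "\<And>a b. \<bar>D b - D a\<bar> \<le> C * \<bar>b - a\<bar>"
    using has_density_Lipschitz[OF D] by auto
  note [measurable] = has_density_measurable[OF D]
  \<comment> \<open>The extra \<open>1\<close> makes \<open>\<psi>\<close> vanish at the end points of \<open>[-r,r]\<close>.\<close>
  define r where "r = \<bar>R\<bar> + 1"
  have r: "r > 0" "R < r" unfolding r_def by auto
  have B0: "B \<ge> 0" using B[of 0] by linarith
  define k where "k = (\<lambda>t s. indicator {-r..r} t * indicator {-r..t} s * h s * \<psi>' t)"
  have km: "(\<lambda>(t,s). k t s) \<in> borel_measurable (lborel \<Otimes>\<^sub>M lborel)"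
  proof -
    have "k = (\<lambda>t s. if -r \<le> t \<and> t \<le> r \<and> -r \<le> s \<and> s \<le> t then h s * \<psi>' t else 0)"
      by (auto simp: k_def fun_eq_iff indicator_def)
    then show ?thesis by simp
  qed
  have ki: "integrable (lborel \<Otimes>\<^sub>M lborel) (\<lambda>(t,s). k t s)"
  proof (rule integrable_bounded_on_finite[OF km, where A="{-r..r} \<times> {-r..r}" and C="C * B"])
    show "emeasure (lborel \<Otimes>\<^sub>M lborel) ({-r..r} \<times> {-r..r}) < \<infinity>"
      using r by (subst lborel.emeasure_pair_measure_Times) (auto simp flip: ennreal_mult')
    show "\<bar>case x of (t, s) \<Rightarrow> k t s\<bar> \<le> C * B" for x
    proof (cases x)
      case (Pair t s)
      have "\<bar>h s\<bar> * \<bar>\<psi>' t\<bar> \<le> C * B" using C(1,2) B by (intro mult_mono) auto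
      then show ?thesis using C(1) B0 by (auto simp: Pair k_def indicator_def abs_mult)
    qed
    show "(case x of (t, s) \<Rightarrow> k t s) = 0" if "x \<notin> {-r..r} \<times> {-r..r}" for x
      using that by (cases x) (auto simp: k_def indicator_def)
  qed auto
  have psi0: "\<psi> (-r) = 0" "\<psi> r = 0" using R r by (auto simp: r_def)
  have "(\<integral>t. D t * \<psi>' t \<partial>lborel) = (\<integral>t. (D (-r)) * (indicator {-r..r} t * \<psi>' t) + (\<integral>s. k t s \<partial>lborel) \<partial>lborel)"
  proof (rule Bochner_Integration.integral_cong[OF refl])
    fix t
    show "D t * \<psi>' t = D (-r) * (indicator {-r..r} t * \<psi>' t) + (\<integral>s. k t s \<partial>lborel)"
    proof (cases "t \<in> {-r..r}")
      case True
      have "(\<integral>s. k t s \<partial>lborel) = (\<integral>s. \<psi>' t * (indicator {-r..t} s * h s) \<partial>lborel)"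
        using True by (intro Bochner_Integration.integral_cong) (auto simp: k_def)
      also have "\<dots> = \<psi>' t * (D t - D (-r))"
        using True Dh[of "-r" t] by (simp add: set_lebesgue_integral_def)
      finally show ?thesis using True by (simp add: algebra_simps)
    next
      case False
      then have "\<bar>t\<bar> > R" using r by (auto simp: r_def)
      then show ?thesis using False R by (simp add: k_def)
    qed
  qed
  also have "\<dots> = D (-r) * (\<integral>t. indicator {-r..r} t * \<psi>' t \<partial>lborel) + (\<integral>t. (\<integral>s. k t s \<partial>lborel) \<partial>lborel)"
  proof (subst Bochner_Integration.integral_add)
    show "integrable lborel (\<lambda>t. D (-r) * (indicator {-r..r} t * \<psi>' t))"
      by (intro integrable_mult_right integrable_bounded_on_finite[where A="{-r..r}" and C=B])
        (use B B0 in \<open>auto simp: indicator_def emeasure_lborel_Icc_eq\<close>)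
    show "integrable lborel (\<lambda>t. \<integral>s. k t s \<partial>lborel)"
      using lborel_pair.integrable_fst'[OF ki] by simp
  qed simp
  also have "(\<integral>t. indicator {-r..r} t * \<psi>' t \<partial>lborel) = 0"
    using integral_deriv_eq[OF d m B, of "-r" r] r psi0 by (simp add: set_lebesgue_integral_def)
  also have "(\<integral>t. (\<integral>s. k t s \<partial>lborel) \<partial>lborel) = (\<integral>s. (\<integral>t. k t s \<partial>lborel) \<partial>lborel)"
    using lborel_pair.Fubini_integral[OF ki] by simp
  also have "\<dots> = (\<integral>s. - (h s * \<psi> s) \<partial>lborel)"
  proof (rule Bochner_Integration.integral_cong[OF refl])
    fix s
    show "(\<integral>t. k t s \<partial>lborel) = - (h s * \<psi> s)"
    proof (cases "s \<in> {-r..r}")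
      case True
      have "(\<integral>t. k t s \<partial>lborel) = (\<integral>t. h s * (indicator {s..r} t * \<psi>' t) \<partial>lborel)"
        using True by (intro Bochner_Integration.integral_cong) (auto simp: k_def indicator_def)
      also have "\<dots> = h s * (\<psi> r - \<psi> s)"
        using integral_deriv_eq[OF d m B, of s r] True by (simp add: set_lebesgue_integral_def)
      finally show ?thesis using psi0 by simp
    next
      case False
      then have "\<bar>s\<bar> > R" using r by (auto simp: r_def)
      moreover have "(\<integral>t. k t s \<partial>lborel) = (\<integral>t. 0 \<partial>(lborel :: real measure))"
        using False by (intro Bochner_Integration.integral_cong) (auto simp: k_def indicator_def)
      ultimately show ?thesis using R by simp
    qed
  qed
  finally show ?thesis by simp
qed

text \<open>
  Both sides are measures that agree on open intervals. The consequence of interest is that the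
  Stieltjes measure of \<open>F\<close> is dominated by Lebesgue measure.
\<close>

lemma lborel_eq_add_interval_measures:
  fixes F G :: "real \<Rightarrow> real"
  assumes F: "mono F" "continuous_on UNIV F" and G: "mono G" "continuous_on UNIV G"
    and FG: "\<And>t. F t + G t = t" and A: "A \<in> sets borel"
  shows "emeasure (interval_measure F) A + emeasure (interval_measure G) A = emeasure lborel A"
proof -
  define M where "M = measure_of UNIV (sets borel)
     (\<lambda>A. emeasure (interval_measure F) A + emeasure (interval_measure G) A)"
  have sM: "sets M = sets borel" unfolding M_def
    using sets.sigma_sets_eq[of borel] by (subst sets_measure_of) auto
  have eM: "emeasure M X = emeasure (interval_measure F) X + emeasure (interval_measure G) X"
    if "X \<in> sets borel" for X
    unfolding M_def
  proof (rule emeasure_measure_of_sigma)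
    show "sigma_algebra UNIV (sets (borel :: real measure))"
      using sets.sigma_algebra_axioms[of borel] by simp
    show "countably_additive (sets borel) (\<lambda>A. emeasure (interval_measure F) A + emeasure (interval_measure G) A)"
      by (auto simp: countably_additive_def suminf_add[symmetric] suminf_emeasure)
  qed (use that in \<open>auto simp: positive_def\<close>)
  have Ioo: "emeasure (interval_measure H) {l<..<u} = ennreal (H u - H l)"
    if "l \<le> u" "mono H" "continuous_on UNIV H" for H :: "real \<Rightarrow> real" and l u
  proof -
    have mo: "\<And>x y. x \<le> y \<Longrightarrow> H x \<le> H y" using that by (simp add: monoD)
    have c: "\<And>a. continuous (at_right a) H"
      using that(3) by (meson UNIV_I continuous_on_eq_continuous_within continuous_within_subset subset_UNIV)
    have c1: "\<And>a. isCont H a" using that(3) by (simp add: continuous_on_eq_continuous_at)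
    have s0: "emeasure (interval_measure H) {x} = 0" for x
      using emeasure_interval_measure_Icc[OF order_refl[of x] mo that(3)] by simp
    show ?thesis
    proof (cases "l < u")
      case True
      have "emeasure (interval_measure H) {l<..u} = emeasure (interval_measure H) ({l<..<u} \<union> {u})"
        using True by (intro arg_cong[where f="emeasure _"]) auto
      also have "\<dots> = emeasure (interval_measure H) {l<..<u}"
        by (intro emeasure_Un_null_set) (auto simp: null_sets_def s0)
      finally show ?thesis using emeasure_interval_measure_Ioc[OF that(1) mo c] by simp
    qed (use that in simp)
  qed
  have "lborel = M"
  proof (rule lborel_eqI)
    fix l u :: real assume lu: "\<And>b. b \<in> Basis \<Longrightarrow> l \<bullet> b \<le> u \<bullet> b"
    then have "l \<le> u" by simp
    then show "emeasure M (box l u) = (\<Prod>b\<in>Basis. (u - l) \<bullet> b)"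
      using Ioo[OF _ F, of l u] Ioo[OF _ G, of l u] FG[of u] FG[of l] monoD[OF F(1), of l u] monoD[OF G(1), of l u]
      by (simp add: box_real eM ennreal_plus[symmetric] del: ennreal_plus)
  qed (fact sM)
  then show ?thesis using eM[OF A] by simp
qed

text \<open>
  For a \<open>1\<close>-Lipschitz \<open>D\<close> both \<open>F = (t + D)/2\<close> and \<open>G = (t - D)/2\<close> are nondecreasing, and
  they add up to the identity. So the Stieltjes measure of \<open>F\<close> is at most Lebesgue measure and has
  a Radon--Nikodym density with values in \<open>[0,1]\<close> almost everywhere; since \<open>D = 2F - t\<close>, twice that density
  minus one serves as the derivative of \<open>D\<close>.
\<close>

lemma Lipschitz_has_density:
  fixes D :: "real \<Rightarrow> real"
  assumes L: "\<And>s t. \<bar>D s - D t\<bar> \<le> \<bar>s - t\<bar>"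
  shows "\<exists>h. has_density D h \<and> (\<forall>t. \<bar>h t\<bar> \<le> 1)"
proof -
  define F where "F = (\<lambda>t. (t + D t) / 2)"
  define G where "G = (\<lambda>t. (t - D t) / 2)"
  have mF: "mono F"
  proof (rule monoI)
    fix s t :: real assume "s \<le> t" then show "F s \<le> F t" using L[of s t] by (simp add: F_def)
  qed
  have mG: "mono G"
  proof (rule monoI)
    fix s t :: real assume "s \<le> t" then show "G s \<le> G t" using L[of s t] by (simp add: G_def)
  qed
  have "1-lipschitz_on UNIV D" using L by (intro lipschitz_onI) (auto simp: dist_real_def)
  then have cD: "continuous_on UNIV D" by (rule lipschitz_on_continuous_on)
  have cF: "continuous_on UNIV F" and cG: "continuous_on UNIV G"
    unfolding F_def G_def by (intro continuous_intros cD; simp)+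
  have FG: "F t + G t = t" for t by (simp add: F_def G_def field_simps)
  have le: "emeasure (interval_measure F) A \<le> emeasure lborel A" if "A \<in> sets borel" for A
    unfolding lborel_eq_add_interval_measures[OF mF cF mG cG FG that, symmetric] by simp
  have "absolutely_continuous lborel (interval_measure F)"
    unfolding absolutely_continuous_def
  proof
    fix A :: "real set" assume "A \<in> null_sets lborel"
    then have A: "A \<in> sets borel" "emeasure lborel A = 0" by auto
    then have "emeasure (interval_measure F) A = 0" using le[OF A(1)] by simp
    then show "A \<in> null_sets (interval_measure F)" using A by (simp add: null_sets_def)
  qed
  then obtain g where g[measurable]: "g \<in> borel_measurable lborel" and dg: "density lborel g = interval_measure F"
    using sigma_finite_measure.Radon_Nikodym[OF sigma_finite_lborel, of "interval_measure F"] by auto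
  \<comment> \<open>Truncation to \<open>[-n,n]\<close> makes the measures finite, so that they can be subtracted.\<close>
  have gle: "AE x in lborel. g x \<le> 1"
  proof -
    define A where "A n = {x \<in> {- real n..real n}. 1 < g x}" for n :: nat
    have Am[measurable]: "A n \<in> sets borel" for n unfolding A_def by measurable
    have "AE x in lborel. x \<notin> A n" for n
    proof -
      have fin: "emeasure lborel (A n) < \<infinity>"
      proof -
        have "emeasure lborel (A n) \<le> emeasure lborel {- real n..real n}"
          by (intro emeasure_mono) (auto simp: A_def)
        also have "\<dots> < \<infinity>" by simp
        finally show ?thesis .
      qed
      have "(\<integral>\<^sup>+x. (g x - 1) * indicator (A n) x \<partial>lborel)
          = (\<integral>\<^sup>+x. g x * indicator (A n) x - indicator (A n) x \<partial>lborel)"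
        by (intro nn_integral_cong) (auto simp: indicator_def)
      also have "\<dots> = (\<integral>\<^sup>+x. g x * indicator (A n) x \<partial>lborel) - (\<integral>\<^sup>+x. indicator (A n) x \<partial>lborel)"
      proof (rule nn_integral_diff)
        show "(\<integral>\<^sup>+x. indicator (A n) x \<partial>lborel) \<noteq> \<infinity>" using fin by simp
      qed (auto simp: A_def indicator_def)
      also have "\<dots> = emeasure (interval_measure F) (A n) - emeasure lborel (A n)"
        unfolding dg[symmetric] by (subst emeasure_density) auto
      also have "\<dots> = 0" using le[OF Am, of n] order_le_less_trans[OF le[OF Am, of n] fin]
        by (simp add: diff_eq_0_iff_ennreal ennreal_minus_eq_0)
      finally have "AE x in lborel. (g x - 1) * indicator (A n) x = 0"
        by (subst (asm) nn_integral_0_iff_AE) auto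
      then show ?thesis
      proof eventually_elim
        case (elim x)
        show ?case
        proof
          assume x: "x \<in> A n"
          then have "g x - 1 = 0" "1 < g x" using elim by (auto simp: A_def)
          then show False by (metis diff_gr0_ennreal less_irrefl ennreal_one_less_top)
        qed
      qed
    qed
    then have "AE x in lborel. \<forall>n. x \<notin> A n" by (simp add: AE_all_countable)
    then show ?thesis
    proof eventually_elim
      case (elim x)
      obtain n :: nat where "\<bar>x\<bar> \<le> real n" using real_arch_simple by blast
      with elim show ?case by (auto simp: A_def abs_le_iff not_less dest!: spec[of _ n])
    qed
  qed
  define h where "h = (\<lambda>t. 2 * enn2real (min 1 (g t)) - 1)"
  have hm[measurable]: "h \<in> borel_measurable borel" unfolding h_def by measurable
  have hb: "\<bar>h t\<bar> \<le> 1" for t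
  proof -
    have "enn2real (min 1 (g t)) \<le> enn2real 1" by (intro enn2real_mono) auto
    then show ?thesis unfolding h_def using enn2real_nonneg[of "min 1 (g t)"] by (simp add: abs_le_iff)
  qed
  have "D b - D a = (LINT s:{a..b}|lborel. h s)" if ab: "a \<le> b" for a b
  proof -
    let ?k = "\<lambda>s. enn2real (min 1 (g s))"
    have kb: "\<bar>?k t\<bar> \<le> 1" for t
      using hb[of t] unfolding h_def by auto
    have ik: "set_integrable lborel {a..b} ?k"
      unfolding set_integrable_def
      by (rule integrable_bounded_on_finite[where A="{a..b}" and C=1])
        (use kb in \<open>auto simp: indicator_def emeasure_lborel_Icc_eq\<close>)
    have "ennreal (LINT s:{a..b}|lborel. ?k s) = (\<integral>\<^sup>+ s. ennreal (indicator {a..b} s * ?k s) \<partial>lborel)"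
      unfolding set_lebesgue_integral_def
      using ik unfolding set_integrable_def by (subst nn_integral_eq_integral) auto
    also have "\<dots> = (\<integral>\<^sup>+ s. g s * indicator {a..b} s \<partial>lborel)"
    proof (rule nn_integral_cong_AE)
      show "AE s in lborel. ennreal (indicator {a..b} s * ?k s) = g s * indicator {a..b} s"
        using gle
      proof eventually_elim
        case (elim s)
        then have "g s < \<infinity>" using order_le_less_trans[OF _ ennreal_one_less_top] by auto
        with elim show ?case by (auto simp: indicator_def min_absorb2)
      qed
    qed
    also have "\<dots> = emeasure (interval_measure F) {a..b}"
      unfolding dg[symmetric] by (subst emeasure_density) auto
    also have "\<dots> = ennreal (F b - F a)"
      by (rule emeasure_interval_measure_Icc[OF ab _ cF]) (use mF in \<open>auto dest: monoD\<close>)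
    finally have "(LINT s:{a..b}|lborel. ?k s) = F b - F a"
      using monoD[OF mF ab] by (subst (asm) ennreal_inj) (auto simp: set_lebesgue_integral_def)
    moreover have "(LINT s:{a..b}|lborel. h s) = 2 * (LINT s:{a..b}|lborel. ?k s) - (LINT s:{a..b}|lborel. 1)"
    proof -
      have "set_integrable lborel {a..b} (\<lambda>s. 2 * ?k s)" using ik by simp
      moreover have "set_integrable lborel {a..b} (\<lambda>_. 1 :: real)"
        unfolding set_integrable_def
        by (rule integrable_bounded_on_finite[where A="{a..b}" and C=1])
          (auto simp: emeasure_lborel_Icc_eq indicator_def)
      ultimately show ?thesis unfolding h_def by (subst set_integral_diff) auto
    qed
    moreover have "(LINT s:{a..b}|lborel. 1 :: real) = b - a"
      using ab by (simp add: set_lebesgue_integral_def)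
    ultimately show ?thesis by (simp add: F_def field_simps)
  qed
  with hm hb show ?thesis unfolding has_density_def by blast
qed

section \<open>Integration by parts in coordinate space\<close>

abbreviation lborel_n :: "nat \<Rightarrow> pt measure" where
  "lborel_n N \<equiv> Pi\<^sub>M {..<N} (\<lambda>_. lborel)"

lemma product_sigma_finite_lborel: "product_sigma_finite (\<lambda>_::nat. lborel :: real measure)"
  by (simp add: product_sigma_finite.intro sigma_finite_lborel)

lemma space_lborel_n: "space (lborel_n N) = space_n N"
  by (simp add: space_PiM)

lemma continuous_map_restrict_top_n: "continuous_map euclidean (top_n N) (\<lambda>x. restrict x {..<N})"
  unfolding continuous_map_componentwise
  by (auto simp: continuous_map_iff_continuous2 intro!: continuous_on_product_coordinates)

lemma embed_measurable:
  "(\<lambda>x i. if i < N then x i else 0) \<in> borel_measurable (lborel_n N)"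
proof (rule measurable_coordinatewise_then_product)
  fix i
  show "(\<lambda>x. if i < N then x i else 0) \<in> borel_measurable (lborel_n N)"
    using measurable_component_singleton[of i "{..<N}" "\<lambda>_. lborel :: real measure"]
    by (cases "i < N") simp_all
qed

lemma restrict_embed:
  assumes "x \<in> space_n N" shows "restrict (\<lambda>i. if i < N then x i else 0) {..<N} = x"
  by (rule ext) (use assms in \<open>auto simp: restrict_def PiE_iff extensional_def\<close>)

lemma openin_top_n_sets:
  assumes "openin (top_n N) U" shows "U \<in> sets (lborel_n N)"
proof -
  let ?V = "{x. restrict x {..<N} \<in> U}"
  have "open ?V"
    using openin_continuous_map_preimage[OF continuous_map_restrict_top_n assms] by simp
  then have "(\<lambda>x i. if i < N then x i else 0) -` ?V \<inter> space (lborel_n N) \<in> sets (lborel_n N)"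
    by (intro measurable_sets[OF embed_measurable]) auto
  moreover have "U \<subseteq> space_n N" using openin_subset[OF assms] by simp
  then have "(\<lambda>x i. if i < N then x i else 0) -` ?V \<inter> space (lborel_n N) = U"
    by (auto simp: space_lborel_n restrict_embed)
  ultimately show ?thesis by simp
qed

text \<open>
  The product \<open>\<sigma>\<close>-algebra is the Borel algebra for functions on all of \<open>nat\<close>; extending a point
  of \<open>N\<close>-space by zero and restricting it back transports this to extensional functions.
\<close>

lemma continuous_map_indicator_measurable:
  assumes U: "openin (top_n N) U" and \<phi>: "continuous_map (subtopology (top_n N) U) euclideanreal \<phi>"
  shows "(\<lambda>x. indicator U x * \<phi> x) \<in> borel_measurable (lborel_n N)"
proof -
  let ?V = "{x. restrict x {..<N} \<in> U}"
  have V: "open ?V"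
    using openin_continuous_map_preimage[OF continuous_map_restrict_top_n U] by simp
  have "continuous_map (subtopology euclidean ?V) (subtopology (top_n N) U) (\<lambda>x. restrict x {..<N})"
    by (intro continuous_map_into_subtopology continuous_map_from_subtopology continuous_map_restrict_top_n) auto
  from continuous_map_compose[OF this \<phi>]
  have "continuous_on ?V (\<lambda>x. \<phi> (restrict x {..<N}))"
    by (simp add: continuous_map_iff_continuous o_def)
  then have "(\<lambda>x. indicator ?V x *\<^sub>R \<phi> (restrict x {..<N})) \<in> borel_measurable borel"
    using V by (intro borel_measurable_continuous_on_indicator) auto
  from measurable_compose[OF embed_measurable this]
  show ?thesis
  proof (rule measurable_cong[THEN iffD1, rotated])
    fix x assume "x \<in> space (lborel_n N)"
    then have "restrict (\<lambda>i. if i < N then x i else 0) {..<N} = x"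
      by (simp add: space_lborel_n restrict_embed)
    then show "indicator ?V (\<lambda>i. if i < N then x i else 0) *\<^sub>R \<phi> (restrict (\<lambda>i. if i < N then x i else 0) {..<N})
        = indicator U x * \<phi> x"
      by (simp add: indicator_def)
  qed
qed

text \<open>
  Bounded, measurable and zero outside a box. The integrands of all integrations by parts belong to
  this class, which is closed under sums and products with functions of one coordinate and consists
  of integrable functions.
\<close>

definition tame :: "nat \<Rightarrow> (pt \<Rightarrow> real) \<Rightarrow> bool" where
  "tame N \<psi> \<longleftrightarrow> \<psi> \<in> borel_measurable (lborel_n N) \<and>
     (\<exists>R B. \<forall>x\<in>space_n N. \<bar>\<psi> x\<bar> \<le> B \<and> (\<psi> x \<noteq> 0 \<longrightarrow> (\<forall>i<N. \<bar>x i\<bar> \<le> R)))"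

lemma tame_measurable: "tame N \<psi> \<Longrightarrow> \<psi> \<in> borel_measurable (lborel_n N)"
  unfolding tame_def by blast

lemma tame_bounds:
  assumes "tame N \<psi>"
  shows "\<exists>R B. R \<ge> 0 \<and> B \<ge> 0 \<and> (\<forall>x\<in>space_n N. \<bar>\<psi> x\<bar> \<le> B \<and> (\<psi> x \<noteq> 0 \<longrightarrow> (\<forall>i<N. \<bar>x i\<bar> \<le> R)))"
proof -
  obtain R B where *: "\<forall>x\<in>space_n N. \<bar>\<psi> x\<bar> \<le> B \<and> (\<psi> x \<noteq> 0 \<longrightarrow> (\<forall>i<N. \<bar>x i\<bar> \<le> R))"
    using assms unfolding tame_def by blast
  have "\<bar>\<psi> x\<bar> \<le> \<bar>B\<bar> \<and> (\<psi> x \<noteq> 0 \<longrightarrow> (\<forall>i<N. \<bar>x i\<bar> \<le> \<bar>R\<bar>))" if "x \<in> space_n N" for x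
    using * that by (meson abs_ge_self order_trans)
  then show ?thesis by (intro exI[of _ "\<bar>R\<bar>"] exI[of _ "\<bar>B\<bar>"]) auto
qed

lemma tameI:
  assumes "\<psi> \<in> borel_measurable (lborel_n N)"
    and "\<And>x. x \<in> space_n N \<Longrightarrow> \<bar>\<psi> x\<bar> \<le> B \<and> (\<psi> x \<noteq> 0 \<longrightarrow> (\<forall>i<N. \<bar>x i\<bar> \<le> R))"
  shows "tame N \<psi>"
  using assms unfolding tame_def by blast

lemma tame_integrable:
  assumes "tame N \<psi>" shows "integrable (lborel_n N) \<psi>"
proof -
  obtain R B where *: "\<And>x. x \<in> space_n N \<Longrightarrow> \<bar>\<psi> x\<bar> \<le> B \<and> (\<psi> x \<noteq> 0 \<longrightarrow> (\<forall>i<N. \<bar>x i\<bar> \<le> R))"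
    using tame_bounds[OF assms] by metis
  interpret product_sigma_finite "\<lambda>_::nat. lborel :: real measure" by (rule product_sigma_finite_lborel)
  show ?thesis
  proof (rule integrable_bounded_on_finite[OF tame_measurable[OF assms], where C=B])
    show "Pi\<^sub>E {..<N} (\<lambda>_. {-R..R}) \<in> sets (lborel_n N)"
      by (rule sets_PiM_I_finite) auto
    have "emeasure (lborel_n N) (Pi\<^sub>E {..<N} (\<lambda>_. {-R..R})) = (\<Prod>i<N. emeasure lborel {-R..R})"
      by (rule emeasure_PiM) auto
    then show "emeasure (lborel_n N) (Pi\<^sub>E {..<N} (\<lambda>_. {-R..R})) < \<infinity>"
      by (simp add: emeasure_lborel_Icc_eq ennreal_power)
    show "\<psi> x = 0" if x: "x \<in> space (lborel_n N)" "x \<notin> Pi\<^sub>E {..<N} (\<lambda>_. {-R..R})" for x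
    proof (rule ccontr)
      assume "\<psi> x \<noteq> 0"
      then have "\<bar>x i\<bar> \<le> R" if "i < N" for i using * x(1) that by (simp add: space_lborel_n)
      then have "x i \<in> {-R..R}" if "i < N" for i using that by (simp add: abs_le_iff minus_le_iff)
      then show False using x by (auto simp: space_lborel_n PiE_iff)
    qed
    qed (use * in \<open>auto simp: space_lborel_n\<close>)
qed

lemma tame_add:
  assumes "tame N \<psi>" "tame N \<xi>" shows "tame N (\<lambda>x. \<psi> x + \<xi> x)"
proof -
  obtain R B where 1: "R \<ge> 0" "\<And>x. x \<in> space_n N \<Longrightarrow> \<bar>\<psi> x\<bar> \<le> B \<and> (\<psi> x \<noteq> 0 \<longrightarrow> (\<forall>i<N. \<bar>x i\<bar> \<le> R))"
    using tame_bounds[OF assms(1)] by metis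
  obtain R' B' where 2: "R' \<ge> 0" "\<And>x. x \<in> space_n N \<Longrightarrow> \<bar>\<xi> x\<bar> \<le> B' \<and> (\<xi> x \<noteq> 0 \<longrightarrow> (\<forall>i<N. \<bar>x i\<bar> \<le> R'))"
    using tame_bounds[OF assms(2)] by metis
  show ?thesis
  proof (rule tameI[where B="B + B'" and R="R + R'"])
    show "(\<lambda>x. \<psi> x + \<xi> x) \<in> borel_measurable (lborel_n N)"
      using assms[THEN tame_measurable] by (rule borel_measurable_add)
    fix x assume x: "x \<in> space_n N"
    show "\<bar>\<psi> x + \<xi> x\<bar> \<le> B + B' \<and> (\<psi> x + \<xi> x \<noteq> 0 \<longrightarrow> (\<forall>i<N. \<bar>x i\<bar> \<le> R + R'))"
    proof (intro conjI impI allI)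
      show "\<bar>\<psi> x + \<xi> x\<bar> \<le> B + B'" using 1(2)[OF x] 2(2)[OF x] by linarith
      fix i assume "\<psi> x + \<xi> x \<noteq> 0" "i < N"
      then consider "\<psi> x \<noteq> 0" | "\<xi> x \<noteq> 0" by force
      then have "\<bar>x i\<bar> \<le> R \<or> \<bar>x i\<bar> \<le> R'"
        by cases (use 1(2)[OF x] 2(2)[OF x] \<open>i < N\<close> in auto)
      then show "\<bar>x i\<bar> \<le> R + R'" using 1(1) 2(1) by linarith
    qed
  qed
qed

lemma tame_mult_coord:
  assumes "tame N \<psi>" "i < N" and g: "g \<in> borel_measurable borel"
    and gb: "\<And>R. \<exists>B. \<forall>t. \<bar>t\<bar> \<le> R \<longrightarrow> \<bar>g t\<bar> \<le> B"
  shows "tame N (\<lambda>x. g (x i) * \<psi> x)"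
proof -
  obtain R B where 1: "R \<ge> 0" "B \<ge> 0" and 2: "\<And>x. x \<in> space_n N \<Longrightarrow> \<bar>\<psi> x\<bar> \<le> B \<and> (\<psi> x \<noteq> 0 \<longrightarrow> (\<forall>i<N. \<bar>x i\<bar> \<le> R))"
    using tame_bounds[OF assms(1)] by metis
  obtain C where C: "\<forall>t. \<bar>t\<bar> \<le> R \<longrightarrow> \<bar>g t\<bar> \<le> C" using gb by blast
  have "\<bar>g 0\<bar> \<le> C" using C 1(1) by simp
  then have C0: "C \<ge> 0" by linarith
  show ?thesis
  proof (rule tameI[where B="C * B" and R=R])
    have "(\<lambda>x. x i) \<in> borel_measurable (lborel_n N)"
      using measurable_component_singleton[of i "{..<N}" "\<lambda>_. lborel :: real measure"] \<open>i < N\<close> by simp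
    from measurable_compose[OF this g] tame_measurable[OF assms(1)]
    show "(\<lambda>x. g (x i) * \<psi> x) \<in> borel_measurable (lborel_n N)" by (rule borel_measurable_times)
    fix x assume x: "x \<in> space_n N"
    show "\<bar>g (x i) * \<psi> x\<bar> \<le> C * B \<and> (g (x i) * \<psi> x \<noteq> 0 \<longrightarrow> (\<forall>i<N. \<bar>x i\<bar> \<le> R))"
    proof (cases "\<psi> x = 0")
      case False
      then have "\<bar>g (x i)\<bar> \<le> C" using C 2[OF x] \<open>i < N\<close> by blast
      then have "\<bar>g (x i)\<bar> * \<bar>\<psi> x\<bar> \<le> C * B" using 2[OF x] C0 by (intro mult_mono) auto
      then show ?thesis using 2[OF x] False by (simp add: abs_mult)
    qed (use 1 C0 in auto)
  qed
qed

lemma tame_cmult: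
  assumes "tame N \<psi>" shows "tame N (\<lambda>x. c * \<psi> x)"
proof -
  obtain R B where 2: "\<And>x. x \<in> space_n N \<Longrightarrow> \<bar>\<psi> x\<bar> \<le> B \<and> (\<psi> x \<noteq> 0 \<longrightarrow> (\<forall>i<N. \<bar>x i\<bar> \<le> R))"
    using tame_bounds[OF assms] by metis
  show ?thesis
  proof (rule tameI[where B="\<bar>c\<bar> * B" and R=R])
    show "(\<lambda>x. c * \<psi> x) \<in> borel_measurable (lborel_n N)"
      using tame_measurable[OF assms] by simp
    show "\<bar>c * \<psi> x\<bar> \<le> \<bar>c\<bar> * B \<and> (c * \<psi> x \<noteq> 0 \<longrightarrow> (\<forall>i<N. \<bar>x i\<bar> \<le> R))" if "x \<in> space_n N" for x
      using 2[OF that] by (simp add: abs_mult mult_left_mono)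
  qed
qed

lemma tame_diff: "tame N \<psi> \<Longrightarrow> tame N \<xi> \<Longrightarrow> tame N (\<lambda>x. \<psi> x - \<xi> x)"
  using tame_add[of N \<psi> "\<lambda>x. - 1 * \<xi> x"] tame_cmult[of N \<xi> "-1"] by simp

lemma tame_coord: "tame N \<psi> \<Longrightarrow> i < N \<Longrightarrow> tame N (\<lambda>x. x i * \<psi> x)"
  by (rule tame_mult_coord[where g="\<lambda>t. t"]) auto

lemma tame_density:
  assumes "has_density D h" "tame N \<psi>" "i < N"
  shows "tame N (\<lambda>x. D (x i) * \<psi> x)" "tame N (\<lambda>x. h (x i) * \<psi> x)"
proof -
  obtain C where C: "C \<ge> 0" "\<And>t. \<bar>h t\<bar> \<le> C" "\<And>a b. \<bar>D b - D a\<bar> \<le> C * \<bar>b - a\<bar>"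
    using has_density_Lipschitz[OF assms(1)] by auto
  show "tame N (\<lambda>x. D (x i) * \<psi> x)"
  proof (rule tame_mult_coord[OF assms(2,3) has_density_measurable[OF assms(1)]])
    fix R
    have "\<bar>D t\<bar> \<le> \<bar>D 0\<bar> + C * R" if "\<bar>t\<bar> \<le> R" for t
      using C(3)[where a=0 and b=t] mult_left_mono[OF that C(1)] by auto
    then show "\<exists>B. \<forall>t. \<bar>t\<bar> \<le> R \<longrightarrow> \<bar>D t\<bar> \<le> B" by blast
  qed
  show "tame N (\<lambda>x. h (x i) * \<psi> x)"
    by (rule tame_mult_coord[OF assms(2,3)]) (use assms(1) C(2) in \<open>auto simp: has_density_def\<close>)
qed

text \<open>
  Fubini with the \<open>i\<close>-th coordinate innermost reduces this to the line.
\<close>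

lemma integration_by_parts_coord:
  assumes D: "has_density D h" and i: "i < N" and t: "tame N \<psi>" "tame N \<psi>'"
    and d: "\<And>x. x \<in> space_n N \<Longrightarrow> ((\<lambda>t. \<psi> (x(i := t))) has_real_derivative \<psi>' x) (at (x i))"
  shows "(\<integral>x. D (x i) * \<psi>' x \<partial>lborel_n N) = - (\<integral>x. h (x i) * \<psi> x \<partial>lborel_n N)"
proof -
  interpret product_sigma_finite "\<lambda>_::nat. lborel :: real measure" by (rule product_sigma_finite_lborel)
  let ?I = "{..<N} - {i}"
  have ins: "insert i ?I = {..<N}" using i by auto
  obtain R where 1: "\<And>x. x \<in> space_n N \<Longrightarrow> \<psi> x \<noteq> 0 \<Longrightarrow> \<bar>x i\<bar> \<le> R"
    using tame_bounds[OF t(1)] i by metis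
  obtain R' B' where 2: "\<And>x. x \<in> space_n N \<Longrightarrow> \<bar>\<psi>' x\<bar> \<le> B'"
    "\<And>x. x \<in> space_n N \<Longrightarrow> \<psi>' x \<noteq> 0 \<Longrightarrow> \<bar>x i\<bar> \<le> R'"
    using tame_bounds[OF t(2)] i by metis
  have int: "integral\<^sup>L (lborel_n N) f = (\<integral>x. (\<integral>y. f (x(i := y)) \<partial>lborel) \<partial>Pi\<^sub>M ?I (\<lambda>_. lborel))"
    if "tame N f" for f
    using product_integral_insert[of ?I i f] tame_integrable[OF that] unfolding ins by simp
  have *: "(\<integral>y. D y * \<psi>' (x(i := y)) \<partial>lborel) = - (\<integral>y. h y * \<psi> (x(i := y)) \<partial>lborel)"
    if x: "x \<in> space (Pi\<^sub>M ?I (\<lambda>_. lborel))" for x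
  proof (rule integration_by_parts_density[OF D, where B=B' and R="max R R'"])
    have xs: "x(i := t) \<in> space_n N" for t
      using x i by (auto simp: space_PiM PiE_iff extensional_def)
    show "((\<lambda>y. \<psi> (x(i := y))) has_real_derivative \<psi>' (x(i := t))) (at t)" for t
      using d[OF xs[of t]] by simp
    have "(\<lambda>y. x(i := y)) \<in> measurable lborel (lborel_n N)"
      using measurable_component_update[OF x, of i] unfolding ins by simp
    from measurable_compose[OF this tame_measurable[OF t(2)]]
    show "(\<lambda>y. \<psi>' (x(i := y))) \<in> borel_measurable borel" by simp
    show "\<bar>\<psi>' (x(i := t))\<bar> \<le> B'" for t using 2(1)[OF xs] .
    show "\<psi> (x(i := t)) = 0" "\<psi>' (x(i := t)) = 0" if "max R R' < \<bar>t\<bar>" for t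
      using 1[OF xs[of t]] 2(2)[OF xs[of t]] that by auto
  qed
  show ?thesis
    unfolding int[OF tame_density(1)[OF D t(2) i]] int[OF tame_density(2)[OF D t(1) i]]
    by (subst Bochner_Integration.integral_minus[symmetric], rule Bochner_Integration.integral_cong) (use * in auto)
qed

lemma continuous_map_line:
  assumes "x \<in> space_n N" "i < N"
  shows "continuous_map euclideanreal (top_n N) (\<lambda>t. x(i := t))"
  unfolding continuous_map_componentwise
  using assms by (auto simp: PiE_iff extensional_def fun_upd_def)

lemma eventually_line_in_open:
  assumes "openin (top_n N) W" "x \<in> W" "i < N"
  shows "eventually (\<lambda>t. x(i := t) \<in> W) (nhds (x i))"
proof -
  have "x \<in> space_n N" using openin_subset[OF assms(1)] assms(2) by auto
  from openin_continuous_map_preimage[OF continuous_map_line[OF this assms(3)] assms(1)]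
  have "open {t. x(i := t) \<in> W}" by simp
  then show ?thesis using assms(2) by (auto simp: eventually_nhds intro!: exI[of _ "{t. x(i := t) \<in> W}"])
qed

lemma smooth_on_partial:
  assumes "smooth_on N U \<phi>" "x \<in> U" "i < N"
  shows "((\<lambda>t. \<phi> (x(i := t))) has_real_derivative partial i \<phi> x) (at (x i))"
proof -
  have "(\<lambda>t. foldr partial [] \<phi> (x(i := t))) field_differentiable at (x i)"
    using assms unfolding smooth_on_def by blast
  then show ?thesis by (simp add: partial_def field_differentiable_derivI)
qed

lemma smooth_on_continuous:
  assumes "smooth_on N U \<phi>"
  shows "continuous_map (subtopology (top_n N) U) euclideanreal \<phi>"
    and "i < N \<Longrightarrow> continuous_map (subtopology (top_n N) U) euclideanreal (partial i \<phi>)"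
proof -
  have *: "continuous_map (subtopology (top_n N) U) euclideanreal (foldr partial js \<phi>)" if "js \<in> lists {..<N}" for js
    using assms that unfolding smooth_on_def by blast
  show "continuous_map (subtopology (top_n N) U) euclideanreal \<phi>" using *[of "[]"] by simp
  show "i < N \<Longrightarrow> continuous_map (subtopology (top_n N) U) euclideanreal (partial i \<phi>)" using *[of "[i]"] by simp
qed

lemma tame_of_compact_support:
  assumes U: "openin (top_n N) U" and c: "continuous_map (subtopology (top_n N) U) euclideanreal \<phi>"
    and K: "compactin (top_n N) K" "K \<subseteq> U" "\<And>x. x \<in> U - K \<Longrightarrow> \<phi> x = 0"
  shows "tame N (\<lambda>x. indicator U x * \<phi> x)"
proof -
  have "compactin (subtopology (top_n N) U) K" using K by (simp add: compactin_subtopology)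
  from image_compactin[OF this c] have "compact (\<phi> ` K)" by simp
  then obtain B where B: "\<And>x. x \<in> K \<Longrightarrow> \<bar>\<phi> x\<bar> \<le> B"
    using compact_imp_bounded[of "\<phi> ` K"] by (auto simp: bounded_iff)
  have "\<exists>r. \<forall>x\<in>K. \<bar>x i\<bar> \<le> r" if "i < N" for i
  proof -
    have "continuous_map (top_n N) euclideanreal (\<lambda>x. x i)"
      using that by (intro continuous_map_product_projection) auto
    from image_compactin[OF K(1) this] have "compact ((\<lambda>x. x i) ` K)" by simp
    from compact_imp_bounded[OF this] show ?thesis by (auto simp: bounded_iff)
  qed
  then obtain r where r: "\<And>i x. i < N \<Longrightarrow> x \<in> K \<Longrightarrow> \<bar>x i\<bar> \<le> r i" by metis
  define R where "R = (\<Sum>i<N. \<bar>r i\<bar>)"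
  have "r i \<le> R" if "i < N" for i
    unfolding R_def using that member_le_sum[of i "{..<N}" "\<lambda>i. \<bar>r i\<bar>"] by fastforce
  then have R: "\<bar>x i\<bar> \<le> R" if "i < N" "x \<in> K" for i x using r[OF that] that(1) by fastforce
  have "\<bar>indicator U x * \<phi> x\<bar> \<le> \<bar>B\<bar> \<and> (indicator U x * \<phi> x \<noteq> 0 \<longrightarrow> (\<forall>i<N. \<bar>x i\<bar> \<le> R))" for x
  proof (cases "x \<in> K")
    case True
    then show ?thesis using B[OF True] R by (auto simp: indicator_def)
  next
    case False
    then show ?thesis using K(3)[of x] by (cases "x \<in> U") auto
  qed
  then show ?thesis unfolding tame_def using continuous_map_indicator_measurable[OF U c] by blast
qed

text \<open>
  A compactly supported function on \<open>U\<close>, extended by zero, stays differentiable along coordinate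
  lines: near points off its support it vanishes identically.
\<close>

lemma smooth_compact_support:
  assumes U: "openin (top_n N) U" and s: "smooth_on N U \<phi>"
    and K: "compactin (top_n N) K" "K \<subseteq> U" "\<And>x. x \<in> U - K \<Longrightarrow> \<phi> x = 0" and i: "i < N"
  shows "tame N (\<lambda>x. indicator U x * \<phi> x)"
    and "tame N (\<lambda>x. indicator U x * partial i \<phi> x)"
    and "x \<in> space_n N \<Longrightarrow> ((\<lambda>t. indicator U (x(i := t)) * \<phi> (x(i := t))) has_real_derivative
           indicator U x * partial i \<phi> x) (at (x i))"
proof -
  have "closedin (top_n N) K"
    using K(1) by (intro compactin_imp_closedin) (auto simp: Hausdorff_space_product_topology)
  then have Kc: "openin (top_n N) (space_n N - K)" by (simp add: closedin_def)
  have UK: "openin (top_n N) (U - K)"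
  proof -
    have "U \<inter> (space_n N - K) = U - K" using openin_subset[OF U] by auto
    then show ?thesis using openin_Int[OF U Kc] by simp
  qed
  have p0: "partial i \<phi> x = 0" if "x \<in> U - K" for x
  proof -
    have "eventually (\<lambda>t. \<phi> (x(i := t)) = 0) (nhds (x i))"
      using eventually_line_in_open[OF UK that i] by eventually_elim (use K(3) in auto)
    from deriv_cong_ev[OF this refl] show ?thesis unfolding partial_def by simp
  qed
  show "tame N (\<lambda>x. indicator U x * \<phi> x)"
    by (rule tame_of_compact_support[OF U smooth_on_continuous(1)[OF s] K])
  show "tame N (\<lambda>x. indicator U x * partial i \<phi> x)"
    by (rule tame_of_compact_support[OF U smooth_on_continuous(2)[OF s i] K(1,2) p0])
  assume x: "x \<in> space_n N"
  show "((\<lambda>t. indicator U (x(i := t)) * \<phi> (x(i := t))) has_real_derivative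
           indicator U x * partial i \<phi> x) (at (x i))"
  proof (cases "x \<in> K")
    case True
    then have xU: "x \<in> U" using K by auto
    have "eventually (\<lambda>t. \<phi> (x(i := t)) = indicator U (x(i := t)) * \<phi> (x(i := t))) (nhds (x i))"
      using eventually_line_in_open[OF U xU i] by eventually_elim simp
    from DERIV_cong_ev[OF refl this refl] smooth_on_partial[OF s xU i] xU show ?thesis by simp
  next
    case False
    then have xc: "x \<in> space_n N - K" using x by simp
    have "eventually (\<lambda>t. 0 = indicator U (x(i := t)) * \<phi> (x(i := t))) (nhds (x i))"
      using eventually_line_in_open[OF Kc xc i]
    proof eventually_elim
      case (elim t)
      then show ?case using K(3)[of "x(i := t)"] by (cases "x(i := t) \<in> U") auto
    qed
    from DERIV_cong_ev[OF refl this refl, of 0]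
    have "((\<lambda>t. indicator U (x(i := t)) * \<phi> (x(i := t))) has_real_derivative 0) (at (x i))" by simp
    moreover have "indicator U x * partial i \<phi> x = 0" using p0[of x] False by (cases "x \<in> U") auto
    ultimately show ?thesis by (simp only:)
  qed
qed

lemma space_leb_n: "space (leb_n N) = space_n N"
  by (simp add: leb_n_def space_lborel_n)

lemma set_integral_leb_n:
  assumes "tame N \<psi>" "\<And>x. x \<in> space_n N \<Longrightarrow> indicator U x * F x = \<psi> x"
  shows "(LINT x:U|leb_n N. F x) = (\<integral>x. \<psi> x \<partial>lborel_n N)"
proof -
  have "(LINT x:U|leb_n N. F x) = (\<integral>x. \<psi> x \<partial>leb_n N)"
    unfolding set_lebesgue_integral_def
    by (rule Bochner_Integration.integral_cong) (use assms(2) in \<open>auto simp: space_leb_n\<close>)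
  also have "\<dots> = (\<integral>x. \<psi> x \<partial>lborel_n N)"
    unfolding leb_n_def using assms(1) by (intro integral_completion) (auto simp: tame_def)
  finally show ?thesis .
qed

section \<open>Smooth functions and the Heisenberg group\<close>

definition smooth1 :: "(real \<Rightarrow> real) \<Rightarrow> bool" where
  "smooth1 g \<longleftrightarrow> (\<forall>n t. (deriv ^^ n) g field_differentiable at t)"

lemma smooth1_differentiable: "smooth1 g \<Longrightarrow> g field_differentiable at t"
  unfolding smooth1_def by (metis funpow_0)

lemma smooth1_deriv: "smooth1 g \<Longrightarrow> smooth1 (deriv g)"
  unfolding smooth1_def by (metis comp_apply funpow_Suc_right)

lemma smooth1I: 
  assumes "g \<in> S" "\<And>g. g \<in> S \<Longrightarrow> deriv g \<in> S" "\<And>g t. g \<in> S \<Longrightarrow> g field_differentiable at t"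
  shows "smooth1 g"
proof -
  have "(deriv ^^ n) g \<in> S" for n by (induction n) (use assms in auto)
  then show ?thesis using assms(3) unfolding smooth1_def by blast
qed

lemma smooth1_ident: "smooth1 (\<lambda>t. t)"
proof (rule smooth1I[where S="{\<lambda>t. t, \<lambda>t. 1, \<lambda>t. 0}"])
  fix g :: "real \<Rightarrow> real" assume "g \<in> {\<lambda>t. t, \<lambda>t. 1, \<lambda>t. 0}"
  moreover have "deriv (\<lambda>t. t) = (\<lambda>t::real. 1)" "deriv (\<lambda>t. 1) = (\<lambda>t::real. 0::real)"
    "deriv (\<lambda>t. 0) = (\<lambda>t::real. 0::real)" by (simp_all add: fun_eq_iff)
  ultimately show "deriv g \<in> {\<lambda>t. t, \<lambda>t. 1, \<lambda>t. 0}" by auto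
next
  fix g :: "real \<Rightarrow> real" and t assume "g \<in> {\<lambda>t. t, \<lambda>t. 1, \<lambda>t. 0}"
  then show "g field_differentiable at t" by auto
qed simp

text \<open>
  A supply of functions closed under partial derivatives, hence smooth: it contains the polynomials
  (for the group law) and products of one-variable bump functions.
\<close>

inductive_set smooth_alg :: "nat \<Rightarrow> (pt \<Rightarrow> real) set" for N where
  const: "(\<lambda>_. c) \<in> smooth_alg N"
| comp: "smooth1 g \<Longrightarrow> i < N \<Longrightarrow> (\<lambda>x. g (x i)) \<in> smooth_alg N"
| add: "f \<in> smooth_alg N \<Longrightarrow> g \<in> smooth_alg N \<Longrightarrow> (\<lambda>x. f x + g x) \<in> smooth_alg N"
| mult: "f \<in> smooth_alg N \<Longrightarrow> g \<in> smooth_alg N \<Longrightarrow> (\<lambda>x. f x * g x) \<in> smooth_alg N"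

lemma smooth_alg_coord: "i < N \<Longrightarrow> (\<lambda>x. x i) \<in> smooth_alg N"
  using smooth_alg.comp[OF smooth1_ident] .

lemma smooth_alg_continuous:
  assumes "f \<in> smooth_alg N" shows "continuous_map (top_n N) euclideanreal f"
  using assms
proof induction
  case (comp g i)
  have "continuous_map (top_n N) euclideanreal (\<lambda>x. x i)"
    using comp by (intro continuous_map_product_projection) auto
  moreover have "continuous_map euclideanreal euclideanreal g"
    using smooth1_differentiable[OF comp(1)] field_differentiable_imp_continuous_at
    by (auto simp: continuous_map_iff_continuous2 intro!: continuous_at_imp_continuous_on)
  ultimately show ?case using continuous_map_compose[of "top_n N" euclideanreal "\<lambda>x. x i" euclideanreal g]
    by (simp add: o_def)
qed (auto intro: continuous_map_add continuous_map_real_mult)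

lemma smooth_alg_partial:
  assumes "f \<in> smooth_alg N" "i < N"
  shows "partial i f \<in> smooth_alg N \<and> (\<forall>x. (\<lambda>t. f (x(i := t))) field_differentiable at (x i))"
  using assms(1)
proof induction
  case (const c)
  have "partial i (\<lambda>_. c) = (\<lambda>_. 0)" by (simp add: partial_def fun_eq_iff)
  then show ?case by (auto intro: smooth_alg.const)
next
  case (comp g j)
  show ?case
  proof (cases "i = j")
    case True
    have "partial i (\<lambda>x. g (x j)) = (\<lambda>x. deriv g (x j))" using True by (simp add: partial_def fun_eq_iff)
    then show ?thesis using True comp smooth1_deriv smooth1_differentiable by (auto intro: smooth_alg.comp)
  next
    case False
    then have "partial i (\<lambda>x. g (x j)) = (\<lambda>_. 0)" by (simp add: partial_def fun_eq_iff)
    then show ?thesis using False by (auto intro: smooth_alg.const)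
  qed
next
  case (add f g)
  have "partial i (\<lambda>x. f x + g x) = (\<lambda>x. partial i f x + partial i g x)"
    unfolding partial_def by (intro ext deriv_add) (use add in blast)+
  then show ?case using add by (auto intro: smooth_alg.add field_differentiable_add)
next
  case (mult f g)
  have "partial i (\<lambda>x. f x * g x) = (\<lambda>x. f x * partial i g x + partial i f x * g x)"
  proof
    fix x
    show "partial i (\<lambda>x. f x * g x) x = f x * partial i g x + partial i f x * g x"
      using deriv_mult[of "\<lambda>t. f (x(i := t))" "x i" "\<lambda>t. g (x(i := t))"] mult
      by (simp add: partial_def del: fun_upd_apply)
  qed
  then show ?case using mult by (auto intro!: smooth_alg.add smooth_alg.mult field_differentiable_mult)
qed

lemma smooth_alg_smooth_on:
  assumes "f \<in> smooth_alg N" shows "smooth_on N U f"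
proof -
  have "foldr partial js f \<in> smooth_alg N" if "js \<in> lists {..<N}" for js
    using that by (induction js) (use assms smooth_alg_partial in auto)
  then show ?thesis unfolding smooth_on_def
    using smooth_alg_continuous smooth_alg_partial by (blast intro: continuous_map_from_subtopology)
qed

text \<open>
  The Heisenberg group in exponential coordinates, where the Baker--Campbell--Hausdorff formula is
  \<open>u * v = u + v + [u,v]/2\<close>.
\<close>

definition heis :: carnot where
  "heis = \<lparr>carrier = space_n 3,
     mult = (\<lambda>x y. \<lambda>i\<in>{..<3}. x i + y i + (if i = 2 then (x 0 * y 1 - x 1 * y 0) / 2 else 0)),
     one = (\<lambda>i\<in>{..<3}. 0), gdim = 3, layer = (\<lambda>i. if i = 2 then 2 else 1)\<rparr>"

lemma heis_simps [simp]:
  "carrier heis = space_n 3" "gdim heis = 3" "\<one>\<^bsub>heis\<^esub> = (\<lambda>i\<in>{..<3}. 0)"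
  "x \<otimes>\<^bsub>heis\<^esub> y = (\<lambda>i\<in>{..<3}. x i + y i + (if i = 2 then (x 0 * y 1 - x 1 * y 0) / 2 else 0))"
  "layer heis i = (if i = 2 then 2 else 1)"
  by (simp_all add: heis_def)

lemma space_3_eqI: "x \<in> space_n 3 \<Longrightarrow> y \<in> space_n 3 \<Longrightarrow> x 0 = y 0 \<Longrightarrow> x 1 = y 1 \<Longrightarrow> x 2 = y 2 \<Longrightarrow> x = y"
proof (rule PiE_ext)
  fix i :: nat assume "x 0 = y 0" "x 1 = y 1" "x 2 = y 2" "i \<in> {..<3}"
  then show "x i = y i" by (cases "i = 0"; cases "i = 1"; cases "i = 2") auto
qed

lemma group_heis: "group heis"
proof (rule groupI)
  fix x assume x: "x \<in> carrier heis"
  show "\<exists>y\<in>carrier heis. y \<otimes>\<^bsub>heis\<^esub> x = \<one>\<^bsub>heis\<^esub>"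
    by (rule bexI[of _ "\<lambda>i\<in>{..<3}. - x i"]) (simp_all add: fun_eq_iff)
next
  fix x assume "x \<in> carrier heis"
  then show "\<one>\<^bsub>heis\<^esub> \<otimes>\<^bsub>heis\<^esub> x = x" by (intro space_3_eqI) auto
next
  fix x y z assume "x \<in> carrier heis" "y \<in> carrier heis" "z \<in> carrier heis"
  then show "x \<otimes>\<^bsub>heis\<^esub> y \<otimes>\<^bsub>heis\<^esub> z = x \<otimes>\<^bsub>heis\<^esub> (y \<otimes>\<^bsub>heis\<^esub> z)"
    by (intro space_3_eqI) (auto simp: field_simps)
qed auto

lemma inv_heis: "x \<in> space_n 3 \<Longrightarrow> inv\<^bsub>heis\<^esub> x = (\<lambda>i\<in>{..<3}. - x i)"
  using group_heis by (intro group.inv_equality) (auto simp: fun_eq_iff)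

lemma bracket_heis: "bracket heis u v = (\<lambda>i\<in>{..<3}. if i = 2 then u 0 * v 1 - u 1 * v 0 else 0)"
proof (rule ext)
  fix i :: nat
  have 2: "(\<lambda>s. deriv (\<lambda>t. s * t * w) 0) = (\<lambda>s. s * w)" for w :: real
  proof
    fix s :: real
    have "((\<lambda>t. s * t * w) has_real_derivative s * w) (at 0)" by (auto intro!: derivative_eq_intros)
    then show "deriv (\<lambda>t. s * t * w) 0 = s * w" by (rule DERIV_imp_deriv)
  qed
  have 3: "deriv (\<lambda>s. s * w) 0 = w" for w :: real
    by (rule DERIV_imp_deriv) (auto intro!: derivative_eq_intros)
  show "bracket heis u v i = (\<lambda>i\<in>{..<3}. if i = 2 then u 0 * v 1 - u 1 * v 0 else 0) i"
  proof (cases "i = 2")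
    case True
    have "(scale 3 s u \<otimes>\<^bsub>heis\<^esub> scale 3 t v) 2 - (scale 3 t v \<otimes>\<^bsub>heis\<^esub> scale 3 s u) 2
         = s * t * (u 0 * v 1 - u 1 * v 0)" for s t
      by (simp add: scale_def field_simps)
    then show ?thesis unfolding bracket_def using True 2 3 by simp
  next
    case False
    then show ?thesis by (simp add: bracket_def scale_def)
  qed
qed

lemma layer_space_heis:
  "layer_space heis 1 = {v \<in> space_n 3. v 2 = 0}"
  "layer_space heis 2 = {v \<in> space_n 3. v 0 = 0 \<and> v 1 = 0}"
  "k \<ge> 3 \<Longrightarrow> layer_space heis k = {\<lambda>i\<in>{..<3}. 0}"
proof -
  have *: "(\<forall>i<3. P i) \<longleftrightarrow> P 0 \<and> P 1 \<and> P (2::nat)" for P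
    by (auto simp: eval_nat_numeral less_Suc_eq)
  show "layer_space heis 1 = {v \<in> space_n 3. v 2 = 0}"
    "layer_space heis 2 = {v \<in> space_n 3. v 0 = 0 \<and> v 1 = 0}"
    by (auto simp: layer_space_def *)
  assume "k \<ge> 3"
  then have "layer_space heis k = {v \<in> space_n 3. v 0 = 0 \<and> v 1 = 0 \<and> v 2 = 0}"
    by (auto simp: layer_space_def *)
  also have "\<dots> = {\<lambda>i\<in>{..<3}. 0}"
  proof (intro equalityI subsetI)
    fix v assume "v \<in> {v \<in> space_n 3. v 0 = 0 \<and> v 1 = 0 \<and> v 2 = 0}"
    then have "v = (\<lambda>i\<in>{..<3}. 0)" by (intro space_3_eqI) simp_all
    then show "v \<in> {\<lambda>i\<in>{..<3}. 0}" by simp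
  qed simp
  finally show "layer_space heis k = {\<lambda>i\<in>{..<3}. 0}" .
qed

lemma bracket_spanI:
  "\<forall>r<(m::nat). u r \<in> V \<and> v r \<in> W \<Longrightarrow>
    (\<lambda>i\<in>{..<gdim G}. \<Sum>r<m. bracket G (u r) (v r) i) \<in> bracket_span G V W"
  unfolding bracket_span_def by (rule CollectI, rule exI[of _ m], rule exI[of _ u], rule exI[of _ v]) simp

text \<open>
  The vertical layer is reached by the single bracket \<open>[e\<^sub>0, w\<^sub>2 e\<^sub>1] = w\<^sub>2 e\<^sub>2\<close>; beyond it all brackets
  vanish because vertical vectors are central.
\<close>

lemma stratified_heis:
  assumes "1 \<le> k"
  shows "bracket_span heis (layer_space heis 1) (layer_space heis k) = layer_space heis (Suc k)"
proof (cases "k = 1")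
  case True
  have "bracket_span heis (layer_space heis 1) (layer_space heis 1) = layer_space heis 2"
  proof (intro equalityI subsetI)
    fix w assume "w \<in> bracket_span heis (layer_space heis 1) (layer_space heis 1)"
    then obtain m u v where "w = (\<lambda>i\<in>{..<gdim heis}. \<Sum>r<(m::nat). bracket heis (u r) (v r) i)"
      unfolding bracket_span_def by blast
    then show "w \<in> layer_space heis 2"
      unfolding layer_space_heis(2) by (simp add: bracket_heis)
  next
    fix w assume "w \<in> layer_space heis 2"
    then have w: "w \<in> space_n 3" "w 0 = 0" "w 1 = 0" by (auto simp: layer_space_heis)
    define c where "c = w 2"
    let ?u = "\<lambda>r::nat. unit_vec 3 0" and ?v = "\<lambda>r::nat. \<lambda>i\<in>{..<3::nat}. if i = 1 then c else 0"
    have "w = (\<lambda>i\<in>{..<gdim heis}. \<Sum>r<(1::nat). bracket heis (?u r) (?v r) i)"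
      using w by (intro space_3_eqI) (simp_all add: bracket_heis unit_vec_def c_def)
    moreover have "\<forall>r<1. ?u r \<in> layer_space heis 1 \<and> ?v r \<in> layer_space heis 1"
      unfolding layer_space_heis(1) by (auto simp: unit_vec_def)
    then have "(\<lambda>i\<in>{..<gdim heis}. \<Sum>r<(1::nat). bracket heis (?u r) (?v r) i)
        \<in> bracket_span heis (layer_space heis 1) (layer_space heis 1)"
      by (rule bracket_spanI)
    ultimately show "w \<in> bracket_span heis (layer_space heis 1) (layer_space heis 1)"
      by (simp only:)
  qed
  then show ?thesis using True by (simp add: numeral_2_eq_2)
next
  case False
  have v0: "v 0 = 0 \<and> v 1 = 0" if "v \<in> layer_space heis k" for v
  proof (cases "k = 2")
    case True then show ?thesis using that by (simp add: layer_space_heis(2))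
  next
    case c: False
    then have "k \<ge> 3" using False assms by simp
    then show ?thesis using that by (simp add: layer_space_heis(3))
  qed
  have "bracket_span heis (layer_space heis 1) (layer_space heis k) = {\<lambda>i\<in>{..<3}. 0}"
  proof (intro equalityI subsetI)
    fix w assume "w \<in> bracket_span heis (layer_space heis 1) (layer_space heis k)"
    then obtain m u v where w: "w = (\<lambda>i\<in>{..<gdim heis}. \<Sum>r<(m::nat). bracket heis (u r) (v r) i)"
      and uv: "\<forall>r<m. u r \<in> layer_space heis 1 \<and> v r \<in> layer_space heis k"
      unfolding bracket_span_def by blast
    have "bracket heis (u r) (v r) i = 0" if "r < m" "i < 3" for r i
    proof -
      have "v r \<in> layer_space heis k" using uv that by blast
      from v0[OF this] show ?thesis using that by (simp add: bracket_heis)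
    qed
    then show "w \<in> {\<lambda>i\<in>{..<3}. 0}" by (auto simp: w fun_eq_iff)
  next
    fix w :: pt assume "w \<in> {\<lambda>i\<in>{..<3}. 0}"
    then show "w \<in> bracket_span heis (layer_space heis 1) (layer_space heis k)"
      unfolding bracket_span_def by (auto intro!: exI[of _ "0::nat"])
  qed
  then show ?thesis using layer_space_heis(3)[of "Suc k"] False assms by simp
qed

lemma carnot_group_heis: "carnot_group heis"
proof -
  interpret group heis by (rule group_heis)
  show ?thesis
  proof
    fix k assume "k < gdim heis"
    then have k: "k < 3" by simp
    have "(\<lambda>z. ((\<lambda>i\<in>{..<3}. z i) \<otimes>\<^bsub>heis\<^esub> (\<lambda>i\<in>{..<3}. z (3 + i))) k)
      = (\<lambda>z. (z k + z (3 + k)) + (if k = 2 then 1 / 2 else 0) * (z 0 * z 4 + (- 1) * (z 1 * z 3)))"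
      using k by (auto simp: fun_eq_iff)
    also have "\<dots> \<in> smooth_alg 6"
      by (intro smooth_alg.intros(1,3,4) smooth_alg_coord) (use k in auto)
    finally show "smooth_on (2 * gdim heis) (space_n (2 * gdim heis))
        (\<lambda>z. ((\<lambda>i\<in>{..<gdim heis}. z i) \<otimes>\<^bsub>heis\<^esub> (\<lambda>i\<in>{..<gdim heis}. z (gdim heis + i))) k)"
      using smooth_alg_smooth_on by (simp only: heis_simps(2)) simp
  next
    fix x s t assume "x \<in> carrier heis"
    then show "scale (gdim heis) s x \<otimes>\<^bsub>heis\<^esub> scale (gdim heis) t x = scale (gdim heis) (s + t) x"
      by (intro space_3_eqI) (auto simp: scale_def field_simps)
  next
    fix k :: nat assume "1 \<le> k"
    then show "bracket_span heis (layer_space heis 1) (layer_space heis k) = layer_space heis (Suc k)"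
      by (rule stratified_heis)
  qed auto
qed

lemma hom_dim_heis: "hom_dim heis = 4"
proof -
  have "step heis = 2"
    unfolding step_def by (rule Least_equality) (auto dest: spec[of _ 2])
  moreover have "{i. i < 3 \<and> (if i = 2 then 2 else 1) = Suc 0} = {0, 1 :: nat}"
    "{i. i < 3 \<and> (if i = 2 then 2 else Suc 0) = 2} = {2 :: nat}" by (auto split: if_splits)
  ultimately show ?thesis by (simp add: hom_dim_def numeral_2_eq_2 del: One_nat_def)
qed

section \<open>Left-invariant derivatives and exterior calculus on the Heisenberg group\<close>

text \<open>
  The chain rule along a line that moves two coordinates. Smoothness is given through continuous
  partial derivatives, so total differentiability in these two coordinates has to be derived.
\<close>

lemma smooth_on_two_coordinates:
  assumes U: "openin (top_n N) U" and s: "smooth_on N U \<phi>" and x: "x \<in> U"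
    and ij: "i < N" "j < N" "i \<noteq> j"
  shows "((\<lambda>t. \<phi> (x(i := x i + t, j := x j + c * t))) has_real_derivative
           (partial i \<phi> x + c * partial j \<phi> x)) (at 0)"
proof -
  define P where "P = (\<lambda>(a, b). x(i := x i + a, j := x j + b))"
  have xs: "x \<in> space_n N" using openin_subset[OF U] x by auto
  have Pc: "continuous_map euclidean (top_n N) P"
    unfolding continuous_map_componentwise
  proof (intro conjI ballI)
    show "P ` topspace euclidean \<subseteq> extensional {..<N}"
      using xs ij by (auto simp: P_def PiE_iff extensional_def)
    fix k
    show "continuous_map euclidean euclideanreal (\<lambda>z. P z k)"
      by (cases "k = j"; cases "k = i")
        (auto simp: P_def case_prod_beta continuous_map_iff_continuous2 intro!: continuous_intros)
  qed
  from openin_continuous_map_preimage[OF Pc U] have op: "open {z. P z \<in> U}" by simp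
  have P0: "P (0, 0) = x" by (simp add: P_def)
  then have "(0, 0) \<in> {z. P z \<in> U}" using x by simp
  with op obtain A B where AB: "open A" "open B" "0 \<in> A" "0 \<in> B" "A \<times> B \<subseteq> {z. P z \<in> U}"
    by (rule open_prod_elim) auto
  have "open (A \<inter> B)" "0 \<in> A \<inter> B" using AB by auto
  then obtain e where e: "e > 0" "ball 0 e \<subseteq> A \<inter> B" by (meson openE)
  let ?X = "ball (0::real) e"
  have PU: "P (a, b) \<in> U" if "a \<in> ?X" "b \<in> ?X" for a b using that e AB by blast
  define Q where "Q = (\<lambda>a b. \<phi> (P (a, b)))"
  define fy where "fy = (\<lambda>a b. blinfun_scaleR_left (partial j \<phi> (P (a, b))))"
  have "((\<lambda>a. Q a 0) has_real_derivative partial i \<phi> x) (at 0)"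
  proof -
    have "((\<lambda>t. \<phi> (x(i := t))) has_real_derivative partial i \<phi> x) (at (0 + x i))"
      using smooth_on_partial[OF s x ij(1)] by simp
    then have "((\<lambda>a. \<phi> (x(i := x i + a))) has_real_derivative partial i \<phi> x) (at 0)"
      unfolding DERIV_shift by (simp only: add.commute)
    then show ?thesis using ij by (simp add: Q_def P_def fun_upd_twist fun_upd_idem)
  qed
  then have fx: "((\<lambda>a. Q a 0) has_derivative (\<lambda>h. h * partial i \<phi> x)) (at 0 within ?X)"
    by (simp add: has_field_derivative_def mult.commute[of _ "partial i \<phi> x"] has_derivative_at_withinI)
  have fyd: "((\<lambda>b. Q a b) has_derivative blinfun_apply (fy a b)) (at b within ?X)"
    if "a \<in> ?X" "b \<in> ?X" for a b
  proof -
    have "((\<lambda>t. \<phi> ((P (a, b))(j := t))) has_real_derivative partial j \<phi> (P (a, b))) (at (b + x j))"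
      using smooth_on_partial[OF s PU[OF that] ij(2)] by (simp add: P_def add.commute)
    then have "((\<lambda>t. \<phi> ((P (a, b))(j := x j + t))) has_real_derivative partial j \<phi> (P (a, b))) (at b)"
      unfolding DERIV_shift by (simp only: add.commute)
    then have "((\<lambda>b. Q a b) has_real_derivative partial j \<phi> (P (a, b))) (at b)"
      by (simp add: Q_def P_def)
    then show ?thesis
      by (simp add: fy_def has_field_derivative_def mult.commute[of _ "partial j \<phi> (P (a, b))"]
          has_derivative_at_withinI blinfun_scaleR_left.rep_eq)
  qed
  have cont: "continuous (at (0, 0) within ?X \<times> ?X) (\<lambda>(a, b). fy a b)"
  proof -
    have "continuous_map (subtopology euclidean (?X \<times> ?X)) (subtopology (top_n N) U) P"
      using PU by (intro continuous_map_into_subtopology continuous_map_from_subtopology Pc) auto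
    from continuous_map_compose[OF this smooth_on_continuous(2)[OF s ij(2)]]
    have "continuous_on (?X \<times> ?X) (\<lambda>z. partial j \<phi> (P z))"
      by (simp add: continuous_map_iff_continuous o_def)
    from bounded_linear.continuous_on[OF bounded_linear_blinfun_scaleR_left this]
    have "continuous_on (?X \<times> ?X) (\<lambda>(a, b). fy a b)"
      by (simp add: fy_def case_prod_beta)
    then show ?thesis using e by (auto simp: continuous_on_eq_continuous_within)
  qed
  have "((\<lambda>(a, b). Q a b) has_derivative (\<lambda>(h, k). h * partial i \<phi> x + fy 0 0 k)) (at (0, 0) within ?X \<times> ?X)"
    by (rule has_derivative_partialsI[OF fx fyd cont]) (use e in auto)
  moreover have w: "at (0::real, 0::real) within ?X \<times> ?X = at (0, 0)"
    using e by (intro at_within_open) (auto intro: open_Times)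
  ultimately have Qd: "((\<lambda>(a, b). Q a b) has_derivative (\<lambda>(h, k). h * partial i \<phi> x + fy 0 0 k)) (at (0, 0))"
    by (simp only:)
  have "((\<lambda>t. (t, c * t)) has_derivative (\<lambda>h. (h, c * h))) (at (0::real))"
    by (auto intro!: derivative_eq_intros)
  from has_derivative_compose[OF this, of "\<lambda>(a, b). Q a b" "(\<lambda>(h, k). h * partial i \<phi> x + fy 0 0 k)"] Qd
  have "((\<lambda>t. Q t (c * t)) has_derivative (\<lambda>h. h * partial i \<phi> x + fy 0 0 (c * h))) (at 0)" by simp
  moreover have "(\<lambda>h. h * partial i \<phi> x + fy 0 0 (c * h)) = (*) (partial i \<phi> x + c * partial j \<phi> x)"
    unfolding fy_def P0 by (auto simp: algebra_simps)
  ultimately show ?thesis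
    by (simp add: has_field_derivative_def Q_def P_def)
qed

lemma lderiv_heis:
  assumes U: "openin (top_n 3) U" and s: "smooth_on 3 U \<phi>" and x: "x \<in> U"
  shows "lderiv heis (unit_vec 3 0) \<phi> x = partial 0 \<phi> x - x 1 / 2 * partial 2 \<phi> x"
    and "lderiv heis (unit_vec 3 1) \<phi> x = partial 1 \<phi> x + x 0 / 2 * partial 2 \<phi> x"
    and "lderiv heis (unit_vec 3 2) \<phi> x = partial 2 \<phi> x"
proof -
  have xs: "x \<in> space_n 3" using openin_subset[OF U] x by auto
  have upd: "y(i := a) \<in> space_n 3" if "y \<in> space_n 3" "i < 3" for y :: pt and i a
    using that by (auto simp: PiE_iff extensional_def)
  have m0: "x \<otimes>\<^bsub>heis\<^esub> scale 3 t (unit_vec 3 0) = x(0 := x 0 + t, 2 := x 2 + (- (x 1 / 2)) * t)" for t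
    using xs by (intro space_3_eqI upd) (simp_all add: scale_def unit_vec_def)
  have m1: "x \<otimes>\<^bsub>heis\<^esub> scale 3 t (unit_vec 3 1) = x(1 := x 1 + t, 2 := x 2 + (x 0 / 2) * t)" for t
    using xs by (intro space_3_eqI upd) (simp_all add: scale_def unit_vec_def)
  have m2: "x \<otimes>\<^bsub>heis\<^esub> scale 3 t (unit_vec 3 2) = x(2 := x 2 + t, 0 := x 0 + 0 * t)" for t
    using xs by (intro space_3_eqI upd) (simp_all add: scale_def unit_vec_def)
  show "lderiv heis (unit_vec 3 0) \<phi> x = partial 0 \<phi> x - x 1 / 2 * partial 2 \<phi> x"
    unfolding lderiv_def heis_simps(2) m0
    using DERIV_imp_deriv[OF smooth_on_two_coordinates[OF U s x, of 0 2 "- (x 1 / 2)"]] by simp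
  show "lderiv heis (unit_vec 3 1) \<phi> x = partial 1 \<phi> x + x 0 / 2 * partial 2 \<phi> x"
    unfolding lderiv_def heis_simps(2) m1
    using DERIV_imp_deriv[OF smooth_on_two_coordinates[OF U s x, of 1 2 "x 0 / 2"]] by simp
  show "lderiv heis (unit_vec 3 2) \<phi> x = partial 2 \<phi> x"
    unfolding lderiv_def heis_simps(2) m2
    using DERIV_imp_deriv[OF smooth_on_two_coordinates[OF U s x, of 2 0 0]] by simp
qed

lemma lderiv_heis_coord:
  assumes "x \<in> space_n 3" "i < 3"
  shows "lderiv heis (unit_vec 3 0) (\<lambda>y. y i) x = (if i = 0 then 1 else if i = 1 then 0 else - x 1 / 2)"
    and "lderiv heis (unit_vec 3 1) (\<lambda>y. y i) x = (if i = 0 then 0 else if i = 1 then 1 else x 0 / 2)"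
proof -
  have U: "openin (top_n 3) (space_n 3)" using openin_topspace[of "top_n 3"] by simp
  have s: "smooth_on 3 (space_n 3) (\<lambda>y. y i)"
    using smooth_alg_smooth_on[OF smooth_alg_coord[OF assms(2)]] .
  have p: "partial j (\<lambda>y. y i) x = (if i = j then 1 else 0)" for j
    by (simp add: partial_def)
  have i: "i = 0 \<or> i = 1 \<or> i = 2" using assms(2) by auto
  show "lderiv heis (unit_vec 3 0) (\<lambda>y. y i) x = (if i = 0 then 1 else if i = 1 then 0 else - x 1 / 2)"
    "lderiv heis (unit_vec 3 1) (\<lambda>y. y i) x = (if i = 0 then 0 else if i = 1 then 1 else x 0 / 2)"
    unfolding lderiv_heis[OF U s assms(1)] p using i by auto
qed

lemma ext_deriv_1:
  "ext_deriv G 1 \<alpha> x [u, v] =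
     lderiv G u (\<lambda>y. \<alpha> y [v]) x - lderiv G v (\<lambda>y. \<alpha> y [u]) x - \<alpha> x [bracket G u v]"
proof -
  have "nths [u, v] (- {0}) = [v]" "nths [u, v] (- {1}) = [u]" "nths [u, v] (- {0, 1}) = []"
    by (simp_all add: nths_Cons)
  moreover have "{..1} = {0, 1 :: nat}" "{..<Suc 0} = {0}" by auto
  ultimately show ?thesis by (simp add: ext_deriv_def)
qed

text \<open>
  The classical formulas with \<open>X = \<partial>\<^sub>0 - x\<^sub>1/2 \<partial>\<^sub>2\<close>, \<open>Y = \<partial>\<^sub>1 + x\<^sub>0/2 \<partial>\<^sub>2\<close>, \<open>T = \<partial>\<^sub>2\<close>; the only
  nonzero bracket \<open>[X,Y] = T\<close> produces the zeroth-order term \<open>- c\<close>.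
\<close>

lemma ext_deriv_1_heis:
  assumes U: "openin (top_n 3) U" and s: "smooth_form heis U 1 \<phi>" and x: "x \<in> U"
  defines "a \<equiv> \<lambda>y. \<phi> y [unit_vec 3 0]" and "b \<equiv> \<lambda>y. \<phi> y [unit_vec 3 1]" and "c \<equiv> \<lambda>y. \<phi> y [unit_vec 3 2]"
  shows "ext_deriv heis 1 \<phi> x [unit_vec 3 0, unit_vec 3 1] =
      partial 0 b x - x 1 / 2 * partial 2 b x - (partial 1 a x + x 0 / 2 * partial 2 a x) - c x"
    and "ext_deriv heis 1 \<phi> x [unit_vec 3 0, unit_vec 3 2] =
      partial 0 c x - x 1 / 2 * partial 2 c x - partial 2 a x"
    and "ext_deriv heis 1 \<phi> x [unit_vec 3 1, unit_vec 3 2] =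
      partial 1 c x + x 0 / 2 * partial 2 c x - partial 2 b x"
    and "ext_deriv heis 1 \<phi> x [unit_vec 3 1, unit_vec 3 0] = - ext_deriv heis 1 \<phi> x [unit_vec 3 0, unit_vec 3 1]"
    and "ext_deriv heis 1 \<phi> x [unit_vec 3 2, unit_vec 3 0] = - ext_deriv heis 1 \<phi> x [unit_vec 3 0, unit_vec 3 2]"
    and "ext_deriv heis 1 \<phi> x [unit_vec 3 2, unit_vec 3 1] = - ext_deriv heis 1 \<phi> x [unit_vec 3 1, unit_vec 3 2]"
proof -
  have e: "unit_vec 3 i \<in> space_n 3" for i by (auto simp: unit_vec_def)
  have sm: "smooth_on 3 U (\<lambda>y. \<phi> y [unit_vec 3 i])" for i
    using s e unfolding smooth_form_def vlists_def by auto
  have lin: "\<phi> x [lincomb 3 p u q v] = p * \<phi> x [u] + q * \<phi> x [v]" if "u \<in> space_n 3" "v \<in> space_n 3" for p q u v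
  proof -
    have "[u] \<in> vlists 3 1" using that by (simp add: vlists_def)
    moreover have "alternating_form 3 1 (\<phi> x)" using s x by (simp add: smooth_form_def)
    then have "\<forall>vs\<in>vlists 3 1. \<forall>i<1. \<forall>u\<in>space_n 3. \<forall>v\<in>space_n 3. \<forall>c d.
        \<phi> x (vs[i := lincomb 3 c u d v]) = c * \<phi> x (vs[i := u]) + d * \<phi> x (vs[i := v])"
      unfolding alternating_form_def by (rule conjunct1)
    ultimately show ?thesis
      using that by (metis list_update_code(2) zero_less_one)
  qed
  have z: "\<phi> x [\<lambda>i\<in>{..<3}. 0] = 0"
  proof -
    have "(\<lambda>i\<in>{..<3}. 0) = lincomb 3 0 (unit_vec 3 0) 0 (unit_vec 3 0)" by (simp add: lincomb_def)
    then show ?thesis using lin[OF e e, of 0 0 0 0] by simp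
  qed
  have br: "bracket heis (unit_vec 3 0) (unit_vec 3 1) = unit_vec 3 2"
    "bracket heis (unit_vec 3 1) (unit_vec 3 0) = lincomb 3 (-1) (unit_vec 3 2) 0 (unit_vec 3 2)"
    "bracket heis (unit_vec 3 0) (unit_vec 3 2) = (\<lambda>i\<in>{..<3}. 0)"
    "bracket heis (unit_vec 3 2) (unit_vec 3 0) = (\<lambda>i\<in>{..<3}. 0)"
    "bracket heis (unit_vec 3 1) (unit_vec 3 2) = (\<lambda>i\<in>{..<3}. 0)"
    "bracket heis (unit_vec 3 2) (unit_vec 3 1) = (\<lambda>i\<in>{..<3}. 0)"
    by (auto simp: bracket_heis unit_vec_def lincomb_def fun_eq_iff)
  note simps = ext_deriv_1 lderiv_heis[OF U sm x] br z lin[OF e e]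
  show "ext_deriv heis 1 \<phi> x [unit_vec 3 0, unit_vec 3 1] =
      partial 0 b x - x 1 / 2 * partial 2 b x - (partial 1 a x + x 0 / 2 * partial 2 a x) - c x"
    "ext_deriv heis 1 \<phi> x [unit_vec 3 0, unit_vec 3 2] =
      partial 0 c x - x 1 / 2 * partial 2 c x - partial 2 a x"
    "ext_deriv heis 1 \<phi> x [unit_vec 3 1, unit_vec 3 2] =
      partial 1 c x + x 0 / 2 * partial 2 c x - partial 2 b x"
    unfolding simps a_def b_def c_def by simp_all
  show "ext_deriv heis 1 \<phi> x [unit_vec 3 1, unit_vec 3 0] = - ext_deriv heis 1 \<phi> x [unit_vec 3 0, unit_vec 3 1]"
    "ext_deriv heis 1 \<phi> x [unit_vec 3 2, unit_vec 3 0] = - ext_deriv heis 1 \<phi> x [unit_vec 3 0, unit_vec 3 2]"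
    "ext_deriv heis 1 \<phi> x [unit_vec 3 2, unit_vec 3 1] = - ext_deriv heis 1 \<phi> x [unit_vec 3 1, unit_vec 3 2]"
    unfolding simps by simp_all
qed

text \<open>
  Of the six permutations, those that differ by a swap of the last two slots give equal terms; the
  division by \<open>1! 2!\<close> cancels this repetition.
\<close>

lemma wedge_1_2:
  assumes "b [v, u] = - b [u, v]" "b [w, u] = - b [u, w]" "b [w, v] = - b [v, w]"
  shows "wedge 1 2 a b [u, v, w] = a [u] * b [v, w] - a [v] * b [u, w] + a [w] * b [u, v]"
proof -
  have f: "finite {1, 2 :: nat}" "0 \<notin> {1, 2 :: nat}" "finite {2 :: nat}" "1 \<notin> {2 :: nat}" by auto
  have i: "{..<1 + 2} = {0, 1, 2 :: nat}" by auto
  have l: "permute_list \<sigma> [u, v, w] = [[u, v, w] ! \<sigma> 0, [u, v, w] ! \<sigma> 1, [u, v, w] ! \<sigma> 2]" for \<sigma>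
    by (simp add: permute_list_def upt_rec numeral_2_eq_2)
  show ?thesis
    unfolding wedge_def i l
    unfolding sum_over_permutations_insert[OF f(1,2)]
    unfolding sum_over_permutations_insert[OF f(3,4)]
    unfolding permutes_sing
    using assms
    by (simp add: sign_swap_id permutation_swap_id sign_compose sign_id transpose_def numeral_2_eq_2 field_simps)
qed

section \<open>Carnot-Caratheodory distance along a horizontal line\<close>

text \<open>
  The one-parameter subgroup \<open>exp(tX)\<close>, a horizontal line through the origin.
\<close>

definition xline :: "real \<Rightarrow> pt" where
  "xline t = (\<lambda>i\<in>{..<3}. if i = 0 then t else 0)"

lemma xline_simps [simp]: "xline t \<in> space_n 3" "xline t 0 = t" "xline t 1 = 0" "xline t (Suc 0) = 0" "xline t 2 = 0"
  by (auto simp: xline_def)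

lemma horizontal_indices_heis: "horizontal_indices heis = {0, 1}"
  by (auto simp: horizontal_indices_def)

text \<open>
  The set whose infimum is the Carnot--Caratheodory distance, given a name because whether it is
  empty has to be discussed.
\<close>

definition path_lengths :: "carnot \<Rightarrow> pt \<Rightarrow> pt \<Rightarrow> real set" where
  "path_lengths G a b = {integral {0..T} (\<lambda>t. sqrt (\<Sum>j\<in>horizontal_indices G. (u j t)\<^sup>2)) | T u \<gamma>.
     horizontal_curve G T u \<gamma> \<and> \<gamma> 0 = a \<and> \<gamma> T = b}"

lemma cc_dist_path_lengths: "cc_dist G a b = Inf (path_lengths G a b)"
  by (simp add: cc_dist_def path_lengths_def)

lemma integral_sqrt_nonneg: "0 \<le> integral S (\<lambda>t::real. sqrt (\<Sum>j\<in>J. (u j t)\<^sup>2))"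
proof (cases "(\<lambda>t. sqrt (\<Sum>j\<in>J. (u j t)\<^sup>2)) integrable_on S")
  case True
  then show ?thesis by (rule Henstock_Kurzweil_Integration.integral_nonneg) (auto intro: sum_nonneg)
qed (simp add: not_integrable_integral)

lemma path_lengths_nonneg: "r \<in> path_lengths G a b \<Longrightarrow> 0 \<le> r"
  unfolding path_lengths_def using integral_sqrt_nonneg by blast

text \<open>
  Prolong the path from \<open>xline s\<close> to \<open>xline t\<close> at unit speed along the line, that is, with
  control \<open>\<plusminus>X\<close> for the additional time \<open>\<bar>t - s\<bar>\<close>.
\<close>

lemma path_lengths_extend:
  assumes "r \<in> path_lengths heis z (xline s)"
  shows "\<exists>r'\<in>path_lengths heis z (xline t). r' \<le> r + \<bar>t - s\<bar>"
proof -
  obtain T u \<gamma> where r: "r = integral {0..T} (\<lambda>t. sqrt (\<Sum>j\<in>horizontal_indices heis. (u j t)\<^sup>2))"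
    and h: "horizontal_curve heis T u \<gamma>" and ends: "\<gamma> 0 = z" "\<gamma> T = xline s"
    using assms unfolding path_lengths_def by blast
  have T: "0 \<le> T" and ui: "\<And>j. j \<in> {0, 1} \<Longrightarrow> u j absolutely_integrable_on {0..T}"
    and gs: "\<And>\<tau>. \<tau> \<in> {0..T} \<Longrightarrow> \<gamma> \<tau> \<in> space_n 3"
    and gi: "\<And>\<tau> i. \<tau> \<in> {0..T} \<Longrightarrow> i < 3 \<Longrightarrow>
       ((\<lambda>x. \<Sum>j\<in>{0,1}. u j x * lderiv heis (unit_vec 3 j) (\<lambda>y. y i) (\<gamma> x)) has_integral (\<gamma> \<tau> i - \<gamma> 0 i)) {0..\<tau>}"
    using h unfolding horizontal_curve_def horizontal_indices_heis heis_simps by blast+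
  define e where "e = \<bar>t - s\<bar>"
  define \<sigma> where "\<sigma> = sgn (t - s)"
  define u' where "u' = (\<lambda>j \<tau>. if \<tau> \<le> T then u j \<tau> else if j = (0::nat) then \<sigma> else 0)"
  define \<gamma>' where "\<gamma>' = (\<lambda>\<tau>. if \<tau> \<le> T then \<gamma> \<tau> else xline (s + \<sigma> * (\<tau> - T)))"
  have e: "e \<ge> 0" "\<sigma> * e = t - s" by (auto simp: e_def \<sigma>_def sgn_if abs_if)
  have \<gamma>'_after: "\<gamma>' \<tau> = xline (s + \<sigma> * (\<tau> - T))" if "T \<le> \<tau>" for \<tau>
    using that ends by (auto simp: \<gamma>'_def)
  have fin: "\<gamma>' (T + e) = xline t" using \<gamma>'_after[of "T + e"] e by simp
  have hc: "horizontal_curve heis (T + e) u' \<gamma>'"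
    unfolding horizontal_curve_def horizontal_indices_heis heis_simps
  proof (intro conjI ballI allI impI)
    show "0 \<le> T + e" using T e by simp
  next
    fix j :: nat assume j: "j \<in> {0, 1}"
    have "u' j absolutely_integrable_on {0..T}"
      by (rule absolutely_integrable_spike[OF ui[OF j], of "{}"]) (auto simp: u'_def)
    moreover have "u' j absolutely_integrable_on {T..T + e}"
    proof (rule absolutely_integrable_spike[where S="{T}"])
      show "(\<lambda>_. if j = 0 then \<sigma> else 0) absolutely_integrable_on {T..T + e}"
        by (rule absolutely_integrable_continuous_real) (intro continuous_intros)
    qed (auto simp: u'_def)
    ultimately have "u' j absolutely_integrable_on ({0..T} \<union> {T..T + e})"
      by (rule absolutely_integrable_Un)
    moreover have "{0..T} \<union> {T..T + e} = {0..T + e}" using T e by auto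
    ultimately show "u' j absolutely_integrable_on {0..T + e}" by simp
  next
    fix \<tau> assume \<tau>: "\<tau> \<in> {0..T + e}"
    show "\<gamma>' \<tau> \<in> space_n 3" using \<tau> gs by (auto simp: \<gamma>'_def)
    fix i :: nat assume i: "i < 3"
    let ?f = "\<lambda>x. \<Sum>j\<in>{0,1}. u' j x * lderiv heis (unit_vec 3 j) (\<lambda>y. y i) (\<gamma>' x)"
    have before: "(?f has_integral (\<gamma>' \<tau> i - \<gamma>' 0 i)) {0..\<tau>}" if "\<tau> \<in> {0..T}" for \<tau>
      using gi[OF that i] that T
      by (subst has_integral_cong[where g="\<lambda>x. \<Sum>j\<in>{0,1}. u j x * lderiv heis (unit_vec 3 j) (\<lambda>y. y i) (\<gamma> x)"])
        (auto simp: u'_def \<gamma>'_def)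
    show "(?f has_integral (\<gamma>' \<tau> i - \<gamma>' 0 i)) {0..\<tau>}"
    proof (cases "\<tau> \<le> T")
      case True
      then show ?thesis using before \<tau> by simp
    next
      case False
      let ?c = "if i = 0 then \<sigma> else 0"
      have c: "?f x = ?c" if "x \<in> {T..\<tau>} - {T}" for x
      proof -
        have x: "T < x" using that by auto
        then have u: "u' 0 x = \<sigma>" "u' 1 x = 0" by (auto simp: u'_def)
        have "lderiv heis (unit_vec 3 0) (\<lambda>y. y i) (\<gamma>' x) = (if i = 0 then 1 else 0)"
          using i x by (subst lderiv_heis_coord(1)) (auto simp: \<gamma>'_after)
        then show ?thesis using u by simp
      qed
      have "((\<lambda>_. ?c) has_integral ?c * (\<tau> - T)) {T..\<tau>}"
        using has_integral_const_real[of ?c T \<tau>] False by (simp add: mult.commute)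
      from has_integral_spike_finite[of "{T}", OF _ c this]
      have "(?f has_integral ?c * (\<tau> - T)) {T..\<tau>}" by simp
      also have "?c * (\<tau> - T) = \<gamma>' \<tau> i - \<gamma>' T i"
        using \<gamma>'_after[of \<tau>] \<gamma>'_after[of T] False i by (auto simp: xline_def)
      finally have after: "(?f has_integral (\<gamma>' \<tau> i - \<gamma>' T i)) {T..\<tau>}" .
      have "(?f has_integral (\<gamma>' T i - \<gamma>' 0 i)) {0..T}" using before T by simp
      from has_integral_combine[OF T _ this after] False show ?thesis by simp
    qed
  qed
  let ?g = "\<lambda>\<tau>. sqrt (\<Sum>j\<in>horizontal_indices heis. (u' j \<tau>)\<^sup>2)"
  have mem: "integral {0..T + e} ?g \<in> path_lengths heis z (xline t)"
  proof -
    have "\<gamma>' 0 = z" using T ends by (simp add: \<gamma>'_def)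
    then show ?thesis unfolding path_lengths_def using hc fin by blast
  qed
  have r0: "r \<ge> 0" unfolding r by (rule integral_sqrt_nonneg)
  \<comment> \<open>A speed that is not integrable has length \<open>0\<close> by convention; the inequality survives that case.\<close>
  have "integral {0..T + e} ?g \<le> r + e"
  proof (cases "?g integrable_on {0..T + e}")
    case False
    then show ?thesis using r0 e by (simp add: not_integrable_integral)
  next
    case True
    have 1: "integral {0..T} ?g = r"
      unfolding r by (rule Henstock_Kurzweil_Integration.integral_cong) (auto simp: u'_def)
    have c: "?g \<tau> = \<bar>\<sigma>\<bar>" if "\<tau> \<in> {T..T + e} - {T}" for \<tau>
      using that by (auto simp: horizontal_indices_heis u'_def)
    have "((\<lambda>_. \<bar>\<sigma>\<bar>) has_integral \<bar>\<sigma>\<bar> * e) {T..T + e}"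
      using has_integral_const_real[of "\<bar>\<sigma>\<bar>" T "T + e"] e by (simp add: mult.commute)
    from has_integral_spike_finite[of "{T}", OF _ c this]
    have "integral {T..T + e} ?g = \<bar>\<sigma>\<bar> * e" by (simp add: integral_unique)
    moreover have "\<bar>\<sigma>\<bar> * e \<le> e" using e by (auto simp: \<sigma>_def sgn_if)
    ultimately show ?thesis using Henstock_Kurzweil_Integration.integral_combine[OF T _ True] e 1 by simp
  qed
  then show ?thesis using mem unfolding e_def by blast
qed

text \<open>
  By prolongation, \<open>xline s\<close> and \<open>xline t\<close> are either both reachable from \<open>z\<close> or both not. In
  the first case prolongation compares the two infima, in the second both are infima of the empty
  set.
\<close>

lemma cc_dist_xline_Lipschitz: "\<bar>cc_dist heis z (xline s) - cc_dist heis z (xline t)\<bar> \<le> \<bar>s - t\<bar>"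
proof -
  have *: "cc_dist heis z (xline t) \<le> cc_dist heis z (xline s) + \<bar>t - s\<bar>" for s t
  proof (cases "path_lengths heis z (xline s) = {}")
    case True
    then have "path_lengths heis z (xline t) = {}" using path_lengths_extend[of _ z t s] by auto
    then show ?thesis using True by (simp add: cc_dist_path_lengths)
  next
    case False
    have "Inf (path_lengths heis z (xline t)) - \<bar>t - s\<bar> \<le> Inf (path_lengths heis z (xline s))"
    proof (rule cInf_greatest[OF False])
      fix r assume "r \<in> path_lengths heis z (xline s)"
      then obtain r' where r': "r' \<in> path_lengths heis z (xline t)" "r' \<le> r + \<bar>t - s\<bar>"
        using path_lengths_extend by blast
      have "Inf (path_lengths heis z (xline t)) \<le> r'"
        by (rule cInf_lower[OF r'(1)]) (auto intro!: bdd_belowI[of _ 0] path_lengths_nonneg)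
      then show "Inf (path_lengths heis z (xline t)) - \<bar>t - s\<bar> \<le> r" using r' by linarith
    qed
    then show ?thesis by (simp add: cc_dist_path_lengths)
  qed
  show ?thesis using *[of s t] *[of t s] by linarith
qed

section \<open>The height map: Sobolev regularity and Pansu derivative\<close>

definition cube :: "real \<Rightarrow> real \<Rightarrow> pt set" where
  "cube a b = Pi\<^sub>E {..<3} (\<lambda>_. {a<..<b})"

abbreviation "big_cube \<equiv> cube (-1) 2"

text \<open>
  The map \<open>f\<close> of the counterexample.
\<close>

definition height_map :: "pt \<Rightarrow> pt" where
  "height_map x = xline (x 2)"

lemma cube_bounds: "x \<in> cube a b \<Longrightarrow> i < 3 \<Longrightarrow> a < x i \<and> x i < b"
  by (auto simp: cube_def PiE_iff)

lemma cube_space: "cube a b \<subseteq> space_n 3"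
  by (auto simp: cube_def PiE_iff)

lemma open_cube: "openin (top_n 3) (cube a b)"
  unfolding cube_def by (subst openin_PiE) auto

lemma open_domain_cube: "a < b \<Longrightarrow> open_domain 3 (cube a b)"
  unfolding open_domain_def
proof (intro conjI open_cube)
  show "connectedin (top_n 3) (cube a b)"
    unfolding cube_def by (subst connectedin_PiE) auto
  assume "a < b"
  then show "cube a b \<noteq> {}" unfolding cube_def by (auto simp: PiE_eq_empty_iff)
qed

lemma cube_sets: "cube a b \<in> sets (lborel_n 3)"
  by (rule openin_top_n_sets[OF open_cube])

lemma emeasure_cube: "a \<le> b \<Longrightarrow> emeasure (lborel_n 3) (cube a b) = ennreal ((b - a) ^ 3)"
proof -
  assume "a \<le> b"
  interpret product_sigma_finite "\<lambda>_::nat. lborel :: real measure" by (rule product_sigma_finite_lborel)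
  have "emeasure (lborel_n 3) (cube a b) = (\<Prod>i<(3::nat). emeasure lborel {a<..<b})"
    unfolding cube_def by (rule emeasure_PiM) auto
  then show ?thesis using \<open>a \<le> b\<close> by (simp add: ennreal_power)
qed

lemma Lp_on_bounded:
  assumes A: "A \<in> sets (lborel_n N)" "emeasure (lborel_n N) A < \<infinity>" and p: "p \<ge> 0"
    and F: "F \<in> borel_measurable (lborel_n N)" "\<And>x. x \<in> A \<Longrightarrow> \<bar>F x\<bar> \<le> B"
  shows "Lp_on N p A F"
  unfolding Lp_on_def
proof
  note [measurable] = A(1) F(1)
  show "set_borel_measurable (leb_n N) A F"
    unfolding set_borel_measurable_def leb_n_def by (intro measurable_completion) measurable
  have "integrable (lborel_n N) (\<lambda>x. indicator A x *\<^sub>R (\<bar>F x\<bar> powr p))"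
  proof (rule integrable_bounded_on_finite[where A=A and C="\<bar>B\<bar> powr p"])
    show "\<bar>indicat_real A x *\<^sub>R \<bar>F x\<bar> powr p\<bar> \<le> \<bar>B\<bar> powr p" for x
      using p F(2)[of x] by (cases "x \<in> A") (auto intro!: powr_mono2)
  qed (use A in auto)
  then show "set_integrable (leb_n N) A (\<lambda>x. \<bar>F x\<bar> powr p)"
    unfolding set_integrable_def leb_n_def by (subst integrable_completion) (auto dest: borel_measurable_integrable)
qed

lemma Lp_loc_bounded:
  assumes p: "p \<ge> 0" and F: "F \<in> borel_measurable (lborel_n 3)" "\<And>x. x \<in> cube a b \<Longrightarrow> \<bar>F x\<bar> \<le> B"
  shows "Lp_loc 3 p (cube a b) F"
  unfolding Lp_loc_def
proof (intro allI impI, elim conjE)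
  fix K assume K: "compactin (top_n 3) K" "K \<subseteq> cube a b"
  have "closedin (top_n 3) K"
    using K(1) by (intro compactin_imp_closedin) (auto simp: Hausdorff_space_product_topology)
  then have "space_n 3 - K \<in> sets (lborel_n 3)"
    by (intro openin_top_n_sets) (simp add: closedin_def)
  then have "space (lborel_n 3) - (space_n 3 - K) \<in> sets (lborel_n 3)" by (rule sets.compl_sets)
  moreover have "space (lborel_n 3) - (space_n 3 - K) = K"
    unfolding space_lborel_n using order_trans[OF K(2) cube_space] by (rule double_diff) (rule subset_refl)
  ultimately have Km: "K \<in> sets (lborel_n 3)" by simp
  have "emeasure (lborel_n 3) K \<le> emeasure (lborel_n 3) (cube (min a b) b)"
  proof (rule emeasure_mono)
    have "cube a b \<subseteq> cube (min a b) b" unfolding cube_def by (rule PiE_mono) auto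
    with K(2) show "K \<subseteq> cube (min a b) b" by (rule order_trans)
  qed (rule cube_sets)
  also have "\<dots> < \<infinity>" by (subst emeasure_cube) auto
  finally show "Lp_on 3 p K F"
    using Lp_on_bounded[OF Km _ p F(1)] F(2) K(2) by blast
qed

lemma coord_measurable: "i < N \<Longrightarrow> (\<lambda>x. x i) \<in> borel_measurable (lborel_n N)"
  using measurable_component_singleton[of i "{..<N}" "\<lambda>_. lborel :: real measure"] by simp

lemma has_density_const: "has_density (\<lambda>_. c) (\<lambda>_. 0)"
  unfolding has_density_def by (auto simp: set_lebesgue_integral_def)

lemma has_density_ident: "has_density (\<lambda>t. t) (\<lambda>_. 1)"
  unfolding has_density_def by (auto simp: set_lebesgue_integral_def)

text \<open>
  The function \<open>D(x\<^sub>2)\<close> is constant in \<open>x\<^sub>0\<close> and \<open>x\<^sub>1\<close>, so only the vertical parts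
  \<open>- x\<^sub>1/2 \<partial>\<^sub>2\<close> and \<open>x\<^sub>0/2 \<partial>\<^sub>2\<close> of \<open>X\<close> and \<open>Y\<close> act on it; the coefficients do not
  depend on \<open>x\<^sub>2\<close> and pass through the integration by parts.
\<close>

lemma weak_lderiv_height:
  assumes D: "has_density D h" and hb: "\<And>t. \<bar>h t\<bar> \<le> 1"
  shows "weak_lderiv heis big_cube 0 (\<lambda>x. D (x 2)) (\<lambda>x. - (x 1 / 2) * h (x 2))"
    and "weak_lderiv heis big_cube 1 (\<lambda>x. D (x 2)) (\<lambda>x. (x 0 / 2) * h (x 2))"
proof -
  have hm: "h \<in> borel_measurable borel" using D by (simp add: has_density_def)
  have m: "(\<lambda>x. x 0) \<in> borel_measurable (lborel_n 3)" "(\<lambda>x. x 1) \<in> borel_measurable (lborel_n 3)"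
    "(\<lambda>x. h (x 2)) \<in> borel_measurable (lborel_n 3)"
    using coord_measurable measurable_compose[OF coord_measurable hm] by auto
  have bd: "\<bar>x i / 2 * h (x 2)\<bar> \<le> 1" if "x \<in> big_cube" "i < 3" for x i
  proof -
    have "\<bar>x i / 2\<bar> * \<bar>h (x 2)\<bar> \<le> 1 * 1"
      using cube_bounds[OF that] hb[of "x 2"] by (intro mult_mono) auto
    then show ?thesis by (simp add: abs_mult)
  qed
  have L: "Lp_loc 3 1 big_cube (\<lambda>x. - (x 1 / 2) * h (x 2))" "Lp_loc 3 1 big_cube (\<lambda>x. (x 0 / 2) * h (x 2))"
    using m bd[of _ 1] bd[of _ 0] by (auto intro!: Lp_loc_bounded[where B=1])
  have main: "(LINT x:big_cube|leb_n 3. D (x 2) * lderiv heis (unit_vec 3 0) \<phi> x)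
        = - (LINT x:big_cube|leb_n 3. - (x 1 / 2) * h (x 2) * \<phi> x) \<and>
      (LINT x:big_cube|leb_n 3. D (x 2) * lderiv heis (unit_vec 3 1) \<phi> x)
        = - (LINT x:big_cube|leb_n 3. (x 0 / 2) * h (x 2) * \<phi> x)" if t: "test_function 3 big_cube \<phi>" for \<phi>
  proof -
    obtain K where s: "smooth_on 3 big_cube \<phi>" and K: "compactin (top_n 3) K" "K \<subseteq> big_cube" "\<And>x. x \<in> big_cube - K \<Longrightarrow> \<phi> x = 0"
      using t unfolding test_function_def by blast
    let ?\<phi> = "\<lambda>x. indicator big_cube x * \<phi> x" and ?d = "\<lambda>i x. indicator big_cube x * partial i \<phi> x"
    note sc = smooth_compact_support[OF open_cube s K]
    have t0: "tame 3 ?\<phi>" by (rule sc(1)[of 0]) simp_all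
    have ti: "tame 3 (?d i)" if "i < 3" for i by (rule sc(2)[OF _ that])
    have di: "((\<lambda>t. ?\<phi> (x(i := t))) has_real_derivative ?d i x) (at (x i))" if "i < 3" "x \<in> space_n 3" for i x
      by (rule sc(3)[OF _ that])
    have horiz: "(\<integral>x. D (x 2) * ?d i x \<partial>lborel_n 3) = 0" if i: "i < 2" for i
    proof -
      have "(\<integral>x. 1 * (D (x 2) * ?d i x) \<partial>lborel_n 3) = - (\<integral>x. 0 * (D (x 2) * ?\<phi> x) \<partial>lborel_n 3)"
      proof (rule integration_by_parts_coord[OF has_density_const, where i=i])
        show "tame 3 (\<lambda>x. D (x 2) * ?\<phi> x)" "tame 3 (\<lambda>x. D (x 2) * ?d i x)"
          using tame_density(1)[OF D] t0 ti i by auto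
        fix x :: pt assume x: "x \<in> space_n 3"
        show "((\<lambda>t. D ((x(i := t)) 2) * ?\<phi> (x(i := t))) has_real_derivative D (x 2) * ?d i x) (at (x i))"
          using DERIV_cmult[OF di[OF _ x, of i], of "D (x 2)"] i by simp
      qed (use i in auto)
      then show ?thesis by simp
    qed
    have vert: "(\<integral>x. D (x 2) * (x i / 2 * ?d 2 x) \<partial>lborel_n 3) = - (\<integral>x. h (x 2) * (x i / 2 * ?\<phi> x) \<partial>lborel_n 3)" if i: "i < 2" for i
    proof (rule integration_by_parts_coord[OF D, where i=2])
      show "tame 3 (\<lambda>x. x i / 2 * ?\<phi> x)" "tame 3 (\<lambda>x. x i / 2 * ?d 2 x)"
        using tame_cmult[OF tame_coord[OF t0, of i], of "1/2"] tame_cmult[OF tame_coord[OF ti[of 2], of i], of "1/2"] i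
        by (simp_all add: algebra_simps)
      fix x :: pt assume x: "x \<in> space_n 3"
      show "((\<lambda>t. (x(2 := t)) i / 2 * ?\<phi> (x(2 := t))) has_real_derivative x i / 2 * ?d 2 x) (at (x 2))"
        using DERIV_cmult[OF di[OF _ x, of 2], of "x i / 2"] i by simp
    qed simp
    have tD: "tame 3 (\<lambda>x. D (x 2) * ?d i x)" if "i < 3" for i
      by (rule tame_density(1)[OF D ti[OF that]]) simp
    have tDx: "tame 3 (\<lambda>x. D (x 2) * (x i / 2 * ?d 2 x))" if "i < 3" for i
      using tame_density(1)[OF D tame_cmult[OF tame_coord[OF ti[of 2] that], of "1/2"], of 2]
      by (simp add: algebra_simps)
    have th: "tame 3 (\<lambda>x. h (x 2) * (x i / 2 * ?\<phi> x))" if "i < 3" for i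
      using tame_density(2)[OF D tame_cmult[OF tame_coord[OF t0 that], of "1/2"], of 2]
      by (simp add: algebra_simps)
    have sp: "(LINT x:big_cube|leb_n 3. c * (x i / 2) * h (x 2) * \<phi> x) = c * (\<integral>x. h (x 2) * (x i / 2 * ?\<phi> x) \<partial>lborel_n 3)"
      if "i < 3" for c i
      using set_integral_leb_n[OF tame_cmult[OF th[OF that], of c], of big_cube "\<lambda>x. c * (x i / 2) * h (x 2) * \<phi> x"]
      by (simp add: mult_ac)
    have "(LINT x:big_cube|leb_n 3. D (x 2) * lderiv heis (unit_vec 3 0) \<phi> x)
        = (\<integral>x. D (x 2) * ?d 0 x - D (x 2) * (x 1 / 2 * ?d 2 x) \<partial>lborel_n 3)"
    proof (rule set_integral_leb_n)
      show "tame 3 (\<lambda>x. D (x 2) * ?d 0 x - D (x 2) * (x 1 / 2 * ?d 2 x))"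
        by (rule tame_diff[OF tD tDx]) auto
      show "indicator big_cube x * (D (x 2) * lderiv heis (unit_vec 3 0) \<phi> x) = D (x 2) * ?d 0 x - D (x 2) * (x 1 / 2 * ?d 2 x)" for x
      proof (cases "x \<in> big_cube")
        case True
        show ?thesis unfolding lderiv_heis(1)[OF open_cube s True] by (simp add: algebra_simps)
      qed simp
    qed
    also have "\<dots> = - (- 1 * (\<integral>x. h (x 2) * (x 1 / 2 * ?\<phi> x) \<partial>lborel_n 3))"
      using horiz[of 0] vert[of 1] tame_integrable[OF tD[of 0]] tame_integrable[OF tDx[of 1]] by simp
    also have "\<dots> = - (LINT x:big_cube|leb_n 3. - (x 1 / 2) * h (x 2) * \<phi> x)"
      using sp[of 1 "-1"] by simp
    finally have 0: "(LINT x:big_cube|leb_n 3. D (x 2) * lderiv heis (unit_vec 3 0) \<phi> x)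
        = - (LINT x:big_cube|leb_n 3. - (x 1 / 2) * h (x 2) * \<phi> x)" .
    have "(LINT x:big_cube|leb_n 3. D (x 2) * lderiv heis (unit_vec 3 1) \<phi> x)
        = (\<integral>x. D (x 2) * ?d 1 x + D (x 2) * (x 0 / 2 * ?d 2 x) \<partial>lborel_n 3)"
    proof (rule set_integral_leb_n)
      show "tame 3 (\<lambda>x. D (x 2) * ?d 1 x + D (x 2) * (x 0 / 2 * ?d 2 x))"
        by (rule tame_add[OF tD tDx]) auto
      show "indicator big_cube x * (D (x 2) * lderiv heis (unit_vec 3 1) \<phi> x) = D (x 2) * ?d 1 x + D (x 2) * (x 0 / 2 * ?d 2 x)" for x
      proof (cases "x \<in> big_cube")
        case True
        show ?thesis unfolding lderiv_heis(2)[OF open_cube s True] by (simp add: algebra_simps)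
      qed simp
    qed
    also have "\<dots> = - (1 * (\<integral>x. h (x 2) * (x 0 / 2 * ?\<phi> x) \<partial>lborel_n 3))"
      using horiz[of 1] vert[of 0] tame_integrable[OF tD[of 1]] tame_integrable[OF tDx[of 0]] by simp
    also have "\<dots> = - (LINT x:big_cube|leb_n 3. (x 0 / 2) * h (x 2) * \<phi> x)"
      using sp[of 0 1] by simp
    finally show ?thesis using 0 by blast
  qed
  show "weak_lderiv heis big_cube 0 (\<lambda>x. D (x 2)) (\<lambda>x. - (x 1 / 2) * h (x 2))"
    "weak_lderiv heis big_cube 1 (\<lambda>x. D (x 2)) (\<lambda>x. (x 0 / 2) * h (x 2))"
    unfolding weak_lderiv_def heis_simps(2) using L main by blast+
qed

text \<open>
  The constant \<open>2\<close> bounds the weak gradient uniformly in \<open>z\<close>: \<open>h\<close> is at most \<open>1\<close> and the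
  coordinates are at most \<open>2\<close> on the cube.
\<close>

lemma sobolev_height_map:
  assumes p: "p \<ge> 0" shows "sobolev_map p heis big_cube heis height_map"
  unfolding sobolev_map_def heis_simps
proof (intro conjI ballI exI)
  show "height_map x \<in> space_n 3" for x by (simp add: height_map_def)
  show "Lp_on 3 p big_cube (\<lambda>_. 2)"
    using p by (intro Lp_on_bounded[where B=2] cube_sets) (auto simp: emeasure_cube)
  fix z :: pt assume "z \<in> space_n 3"
  let ?D = "\<lambda>t. cc_dist heis z (xline t)"
  have lip: "\<bar>?D s - ?D t\<bar> \<le> \<bar>s - t\<bar>" for s t by (rule cc_dist_xline_Lipschitz)
  have hd: "has_density ?D (SOME h. has_density ?D h \<and> (\<forall>t. \<bar>h t\<bar> \<le> 1))"
    and hb: "\<bar>(SOME h. has_density ?D h \<and> (\<forall>t. \<bar>h t\<bar> \<le> 1)) t\<bar> \<le> 1" for t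
    using someI_ex[OF Lipschitz_has_density[of ?D, OF lip]] by blast+
  let ?h = "SOME h. has_density ?D h \<and> (\<forall>t. \<bar>h t\<bar> \<le> 1)"
  let ?DD = "\<lambda>j x. if j = (0::nat) then - (x 1 / 2) * ?h (x 2) else (x 0 / 2) * ?h (x (2::nat))"
  show "Lp_loc 3 p big_cube (\<lambda>x. cc_dist heis z (height_map x))"
    unfolding height_map_def
  proof (rule Lp_loc_bounded[OF p])
    show "(\<lambda>x. ?D (x 2)) \<in> borel_measurable (lborel_n 3)"
      by (rule measurable_compose[OF coord_measurable has_density_measurable[OF hd]]) simp
    show "\<bar>?D (x 2)\<bar> \<le> \<bar>?D 0\<bar> + 2" if "x \<in> big_cube" for x
      using lip[of "x 2" 0] cube_bounds[OF that, of 2] by linarith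
  qed
  show "weak_lderiv heis big_cube j (\<lambda>x. cc_dist heis z (height_map x)) (?DD j)" if "j \<in> horizontal_indices heis" for j
    using that weak_lderiv_height[OF hd hb] by (auto simp: horizontal_indices_heis height_map_def)
  show "AE x in leb_n 3. x \<in> big_cube \<longrightarrow> sqrt (\<Sum>j\<in>horizontal_indices heis. (?DD j x)\<^sup>2) \<le> 2"
  proof (rule AE_I2, rule impI)
    fix x assume x: "x \<in> big_cube"
    have bd: "(x i / 2 * ?h (x 2))\<^sup>2 \<le> 1" if "i < 3" for i
    proof -
      have "\<bar>x i / 2\<bar> * \<bar>?h (x 2)\<bar> \<le> 1 * 1"
        using cube_bounds[OF x that] hb[of "x 2"] by (intro mult_mono) auto
      then have "\<bar>x i / 2 * ?h (x 2)\<bar> \<le> 1" by (simp add: abs_mult)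
      then show ?thesis by (simp add: abs_square_le_1)
    qed
    have "(\<Sum>j\<in>horizontal_indices heis. (?DD j x)\<^sup>2) \<le> 2\<^sup>2"
      using bd[of 0] bd[of 1] by (simp add: horizontal_indices_heis)
    then show "sqrt (\<Sum>j\<in>horizontal_indices heis. (?DD j x)\<^sup>2) \<le> 2"
      by (rule real_le_lsqrt[rotated 1]) simp
  qed
qed

text \<open>
  The horizontal differential of the coordinate \<open>x\<^sub>2\<close> at \<open>x\<close>, with values in the line spanned by \<open>X\<close>.
\<close>

definition pansu_height :: "pt \<Rightarrow> pt \<Rightarrow> pt" where
  "pansu_height x y = xline ((x 0 * y 1 - x 1 * y 0) / 2)"

text \<open>
  The height of \<open>x * \<delta>\<^sub>r y\<close> exceeds that of \<open>x\<close> by \<open>r (x\<^sub>0 y\<^sub>1 - x\<^sub>1 y\<^sub>0)/2 + r\<^sup>2 y\<^sub>2\<close>. As the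
  image line has weight \<open>1\<close>, this is divided by \<open>r\<close>, and the contribution of \<open>y\<^sub>2\<close> tends to zero:
  here the vertical derivative of \<open>f\<close> gets lost.
\<close>

lemma has_pansu_derivative_height:
  assumes x: "x \<in> space_n 3"
  shows "has_pansu_derivative heis heis height_map (pansu_height x) x"
  unfolding has_pansu_derivative_def
proof (intro conjI allI impI ballI)
  show "pansu_height x \<in> hom heis heis"
  proof (rule homI)
    fix y z assume "y \<in> carrier heis" "z \<in> carrier heis"
    show "pansu_height x (y \<otimes>\<^bsub>heis\<^esub> z) = pansu_height x y \<otimes>\<^bsub>heis\<^esub> pansu_height x z"
      by (rule space_3_eqI) (auto simp: pansu_height_def field_simps)
  qed (simp add: pansu_height_def)
  show "pansu_height x (dilation heis r y) = dilation heis r (pansu_height x y)" for r y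
    by (rule space_3_eqI) (auto simp: pansu_height_def dilation_def field_simps)
  fix K i assume K: "compactin (top_n (gdim heis)) K" and i: "i < gdim heis"
  have "continuous_map (top_n 3) euclideanreal (\<lambda>x. x 2)"
    by (intro continuous_map_product_projection) auto
  from image_compactin[OF _ this] K have "compact ((\<lambda>x. x 2) ` K)" by simp
  then obtain B where B: "\<And>y. y \<in> K \<Longrightarrow> \<bar>y 2\<bar> \<le> B"
    using compact_imp_bounded by (force simp: bounded_iff)
  have q: "dilation heis (1 / r) (inv\<^bsub>heis\<^esub> (height_map x) \<otimes>\<^bsub>heis\<^esub> height_map (x \<otimes>\<^bsub>heis\<^esub> dilation heis r y)) i
      = pansu_height x y i + (if i = 0 then r * y 2 else 0)" if "r > 0" for r y
  proof -
    have "i = 0 \<or> i = 1 \<or> i = 2" using i by auto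
    then show ?thesis using that
      by (auto simp: dilation_def inv_heis height_map_def pansu_height_def field_simps power2_eq_square)
  qed
  show "uniform_limit K
      (\<lambda>r y. dilation heis (1 / r) (inv\<^bsub>heis\<^esub> (height_map x) \<otimes>\<^bsub>heis\<^esub> height_map (x \<otimes>\<^bsub>heis\<^esub> dilation heis r y)) i)
      (\<lambda>y. pansu_height x y i) (at_right 0)"
  proof (rule uniform_limitI)
    fix e :: real assume e: "e > 0"
    have B1: "\<bar>B\<bar> + 1 > 0" by simp
    then have "e / (\<bar>B\<bar> + 1) > 0" using e by simp
    then have "eventually (\<lambda>r. r \<in> {0<..<e / (\<bar>B\<bar> + 1)}) (at_right 0)"
      by (rule eventually_at_right_real)
    then show "\<forall>\<^sub>F r in at_right 0. \<forall>y\<in>K.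
      dist (dilation heis (1 / r) (inv\<^bsub>heis\<^esub> (height_map x) \<otimes>\<^bsub>heis\<^esub> height_map (x \<otimes>\<^bsub>heis\<^esub> dilation heis r y)) i)
           (pansu_height x y i) < e"
    proof eventually_elim
      case (elim r)
      show ?case
      proof
        fix y assume y: "y \<in> K"
        have r: "r > 0" "r * (\<bar>B\<bar> + 1) < e" using elim B1 by (auto simp: field_simps)
        have "r * \<bar>y 2\<bar> \<le> r * (\<bar>B\<bar> + 1)" using B[OF y] r(1) by (intro mult_left_mono) auto
        then have "r * \<bar>y 2\<bar> < e" using r(2) by linarith
        then have "\<bar>r * y 2\<bar> < e" using r(1) by (simp add: abs_mult)
        then show "dist (dilation heis (1 / r) (inv\<^bsub>heis\<^esub> (height_map x) \<otimes>\<^bsub>heis\<^esub> height_map (x \<otimes>\<^bsub>heis\<^esub> dilation heis r y)) i)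
           (pansu_height x y i) < e"
          using q[OF r(1)] e by (simp only:) (simp add: dist_real_def)
      qed
    qed
  qed
qed

lemma pansu_differentiable_height: "pansu_differentiable_ae heis U heis height_map"
  unfolding pansu_differentiable_ae_def
  by (rule AE_I2) (use has_pansu_derivative_height in \<open>auto simp: space_leb_n\<close>)

text \<open>
  Evaluating the defining limit at a single point determines the value there. Uniqueness identifies
  the derivative, which is defined by a choice.
\<close>

lemma pansu_derivative_unique:
  assumes "has_pansu_derivative G heis f L x" "has_pansu_derivative G heis f L' x"
    and y: "y \<in> carrier G" "y \<in> space_n (gdim G)"
  shows "L y = L' y"
proof -
  have c: "compactin (top_n (gdim G)) {y}" using y by simp
  have "L y i = L' y i" if "i < 3" for i
  proof -
    have u: "uniform_limit {y} (\<lambda>r y. dilation heis (1 / r) (inv\<^bsub>heis\<^esub> (f x) \<otimes>\<^bsub>heis\<^esub> f (x \<otimes>\<^bsub>G\<^esub> dilation G r y)) i) (\<lambda>y. L y i) (at_right 0)"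
      "uniform_limit {y} (\<lambda>r y. dilation heis (1 / r) (inv\<^bsub>heis\<^esub> (f x) \<otimes>\<^bsub>heis\<^esub> f (x \<otimes>\<^bsub>G\<^esub> dilation G r y)) i) (\<lambda>y. L' y i) (at_right 0)"
      using assms c that unfolding has_pansu_derivative_def heis_simps(2) by blast+
    show ?thesis
      by (rule tendsto_unique[OF trivial_limit_at_right_real
            tendsto_uniform_limitI[OF u(1) singletonI] tendsto_uniform_limitI[OF u(2) singletonI]])
  qed
  moreover have "L y \<in> space_n 3" "L' y \<in> space_n 3"
    using assms unfolding has_pansu_derivative_def hom_def by auto
  ultimately show ?thesis by (intro space_3_eqI) auto
qed

lemma pansu_derivative_height:
  assumes "x \<in> space_n 3" "y \<in> space_n 3"
  shows "pansu_derivative heis heis height_map x y = pansu_height x y"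
proof -
  note d = has_pansu_derivative_height[OF assms(1)]
  have "has_pansu_derivative heis heis height_map (pansu_derivative heis heis height_map x) x"
    unfolding pansu_derivative_def
    by (rule someI[where P="\<lambda>L. has_pansu_derivative heis heis height_map L x", OF d])
  from pansu_derivative_unique[OF this d] show ?thesis using assms(2) by simp
qed

section \<open>The forms, their weights and the nonvanishing integral\<close>

text \<open>
  The functions \<open>P(1/t) e\<^bsup>-1/t\<^esup>\<close>, extended by zero to \<open>t \<le> 0\<close>. They are closed under
  differentiation, which makes all of them smooth.
\<close>

definition flat :: "real poly \<Rightarrow> real \<Rightarrow> real" where
  "flat p t = (if 0 < t then poly p (1 / t) * exp (- (1 / t)) else 0)"

lemma poly_times_exp_tendsto_0:
  fixes p :: "real poly"
  shows "((\<lambda>s. s ^ k * poly p s * exp (- s)) \<longlongrightarrow> 0) at_top"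
proof (induction p arbitrary: k)
  case 0
  then show ?case by simp
next
  case (pCons a p)
  have "((\<lambda>s. a * (s ^ k / exp s) + s ^ Suc k * poly p s * exp (- s)) \<longlongrightarrow> a * 0 + 0) at_top"
    by (intro tendsto_add tendsto_mult tendsto_const tendsto_power_div_exp_0 pCons.IH)
  then show ?case by (simp add: algebra_simps exp_minus divide_inverse)
qed

text \<open>
  At the origin the difference quotient from the right is \<open>s P(s) e\<^bsup>-s\<^esup>\<close> with \<open>s = 1/h\<close>, which tends to zero.
\<close>

lemma flat_has_derivative:
  "(flat p has_real_derivative flat ([:0, 0, 1:] * (p - pderiv p)) t) (at t)"
proof -
  consider "t < 0" | "t = 0" | "t > 0" by linarith
  then show ?thesis
  proof cases
    case 1
    have "eventually (\<lambda>s. s \<in> {..<0}) (nhds t)" using 1 by (intro eventually_nhds_in_open) auto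
    then have "eventually (\<lambda>s. flat p s = 0) (nhds t)" by eventually_elim (simp add: flat_def)
    from DERIV_cong_ev[OF refl this refl, of 0] have "(flat p has_real_derivative 0) (at t)" by simp
    moreover have "flat ([:0, 0, 1:] * (p - pderiv p)) t = 0" using 1 by (simp add: flat_def)
    ultimately show ?thesis by (simp only:)
  next
    case 3
    have "eventually (\<lambda>s. s \<in> {0<..}) (nhds t)" using 3 by (intro eventually_nhds_in_open) auto
    then have ev: "eventually (\<lambda>s. flat p s = poly p (1 / s) * exp (- (1 / s))) (nhds t)"
      by eventually_elim (simp add: flat_def)
    have "((\<lambda>s. poly p (1 / s) * exp (- (1 / s))) has_real_derivative
        flat ([:0, 0, 1:] * (p - pderiv p)) t) (at t)"
      using 3 by (auto intro!: derivative_eq_intros DERIV_chain2[OF poly_DERIV] simp: flat_def field_simps power2_eq_square)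
    then show ?thesis using DERIV_cong_ev[OF refl ev refl] by simp
  next
    case 2
    have "((\<lambda>h. (flat p h - flat p 0) / h) \<longlongrightarrow> 0) (at_right 0)"
    proof -
      have "((\<lambda>h. inverse h ^ 1 * poly p (inverse h) * exp (- inverse h)) \<longlongrightarrow> (0::real)) (at_right 0)"
        by (rule filterlim_compose[OF poly_times_exp_tendsto_0 filterlim_inverse_at_top_right])
      moreover have "eventually (\<lambda>h. inverse h ^ 1 * poly p (inverse h) * exp (- inverse h) = (flat p h - flat p 0) / h) (at_right 0)"
        using eventually_at_right_less[of 0] by eventually_elim (simp add: flat_def divide_inverse)
      ultimately show ?thesis by (rule Lim_transform_eventually)
    qed
    moreover have "((\<lambda>h. (flat p h - flat p 0) / h) \<longlongrightarrow> 0) (at_left 0)"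
    proof (rule tendsto_eventually)
      show "eventually (\<lambda>h. (flat p h - flat p 0) / h = 0) (at_left 0)"
        using eventually_at_left_real[of "-1" 0] by (auto elim!: eventually_mono simp: flat_def)
    qed
    ultimately have "((\<lambda>h. (flat p h - flat p 0) / h) \<longlongrightarrow> 0) (at 0)"
      by (simp add: filterlim_split_at)
    then show ?thesis using 2 by (simp add: has_field_derivative_iff flat_def)
  qed
qed

lemma smooth1_flat: "smooth1 (flat p)"
proof (rule smooth1I[where S="range flat"])
  fix g assume "g \<in> range flat"
  then obtain p where g: "g = flat p" by blast
  have "deriv g = flat ([:0, 0, 1:] * (p - pderiv p))"
    unfolding g by (intro ext DERIV_imp_deriv flat_has_derivative)
  then show "deriv g \<in> range flat" by blast
  show "g field_differentiable at t" for t
    unfolding g field_differentiable_def using flat_has_derivative by blast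
qed simp

lemma smooth1_flat_reflect: "smooth1 (\<lambda>t. flat p (1 - t))"
proof (rule smooth1I[where S="{\<lambda>t. c * flat p (1 - t) | c p. True}"])
  show "(\<lambda>t. flat p (1 - t)) \<in> {\<lambda>t. c * flat p (1 - t) | c p. True}"
    by (intro CollectI exI[of _ "1::real"] exI[of _ p]) simp
  fix g assume "g \<in> {\<lambda>t. c * flat p (1 - t) | c p. True}"
  then obtain c p where g: "g = (\<lambda>t. c * flat p (1 - t))" by blast
  have d: "(g has_real_derivative - c * flat ([:0, 0, 1:] * (p - pderiv p)) (1 - t)) (at t)" for t
    unfolding g by (rule derivative_eq_intros DERIV_chain2[OF flat_has_derivative] | simp)+
  have "deriv g = (\<lambda>t. - c * flat ([:0, 0, 1:] * (p - pderiv p)) (1 - t))"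
    by (intro ext DERIV_imp_deriv d)
  then show "deriv g \<in> {\<lambda>t. c * flat p (1 - t) | c p. True}" by blast
  show "g field_differentiable at t" for t
    unfolding field_differentiable_def using d by blast
qed

definition bump1 :: "real \<Rightarrow> real" where
  "bump1 t = flat 1 t * flat 1 (1 - t)"

definition bump :: "pt \<Rightarrow> real" where
  "bump x = bump1 (x 0) * bump1 (x 1) * bump1 (x 2)"

lemma bump1_nonneg: "0 \<le> bump1 t"
  by (simp add: bump1_def flat_def)

lemma bump1_pos_iff: "bump1 t \<noteq> 0 \<longleftrightarrow> 0 < t \<and> t < 1"
  by (simp add: bump1_def flat_def)

lemma bump_nonneg: "0 \<le> bump x"
  by (simp add: bump_def bump1_nonneg)

lemma bump_smooth_alg: "bump \<in> smooth_alg 3"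
proof -
  have "(\<lambda>x. bump1 (x i)) \<in> smooth_alg 3" if "i < 3" for i
    unfolding bump1_def using smooth_alg.comp[OF smooth1_flat that] smooth_alg.comp[OF smooth1_flat_reflect that]
    by (rule smooth_alg.mult)
  then have "(\<lambda>x. bump1 (x 0) * bump1 (x 1) * bump1 (x 2)) \<in> smooth_alg 3"
    by (intro smooth_alg.mult) auto
  then show ?thesis by (simp add: bump_def[abs_def])
qed

definition closed_cube :: "pt set" where
  "closed_cube = Pi\<^sub>E {..<3} (\<lambda>_. {0..1})"

lemma compactin_closed_cube: "compactin (top_n 3) closed_cube"
  unfolding closed_cube_def by (subst compactin_PiE) auto

lemma closed_cube_subset: "closed_cube \<subseteq> big_cube"
  unfolding closed_cube_def cube_def by (rule PiE_mono) auto

lemma bump_outside: "x \<in> space_n 3 \<Longrightarrow> x \<notin> closed_cube \<Longrightarrow> bump x = 0"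
proof (rule ccontr)
  assume x: "x \<in> space_n 3" "x \<notin> closed_cube" "bump x \<noteq> 0"
  then have "bump1 (x 0) \<noteq> 0" "bump1 (x 1) \<noteq> 0" "bump1 (x 2) \<noteq> 0"
    by (simp_all add: bump_def)
  note b = this[THEN bump1_pos_iff[THEN iffD1]]
  have "x i \<in> {0..1}" if "i < 3" for i
  proof -
    have "i = 0 \<or> i = 1 \<or> i = 2" using that by linarith
    then show ?thesis using b by (elim disjE) simp_all
  qed
  then have "x \<in> closed_cube" using x(1) unfolding closed_cube_def by (auto simp: PiE_iff)
  with x(2) show False by simp
qed

lemma cube_not_null: "a < b \<Longrightarrow> \<not> (AE x in lborel_n 3. x \<notin> cube a b)"
proof
  assume ab: "a < b" and "AE x in lborel_n 3. x \<notin> cube a b"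
  then have "emeasure (lborel_n 3) (cube a b) = 0"
    using cube_space[of a b] by (subst (asm) AE_iff_measurable[OF cube_sets]) (auto simp: space_lborel_n)
  then show False using ab by (simp add: emeasure_cube ennreal_eq_0_iff)
qed

text \<open>
  The form \<open>h \<theta>\<close> for the bump function \<open>h\<close>.
\<close>

definition eta :: "pt \<Rightarrow> covector" where
  "eta x vs = bump x * (hd vs) 2"

text \<open>
  The form \<open>d(x\<^sub>0 + x\<^sub>2)\<close> in the left-invariant frame, where \<open>dx\<^sub>2 = \<theta> + (x\<^sub>0 dx\<^sub>1 - x\<^sub>1 dx\<^sub>0)/2\<close>.
\<close>

definition omega :: "pt \<Rightarrow> covector" where
  "omega x vs = (hd vs) 0 + (hd vs) 2 + (x 0 * (hd vs) 1 - x 1 * (hd vs) 0) / 2"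

lemma vlists_1: "vlists N 1 = (\<lambda>v. [v]) ` space_n N"
proof (intro equalityI subsetI)
  fix vs assume vs: "vs \<in> vlists N 1"
  then have "length vs = Suc 0" by (simp add: vlists_def)
  then obtain v where v: "vs = [v]" unfolding length_Suc_conv by blast
  then have "v \<in> space_n N" using vs by (simp add: vlists_def)
  then show "vs \<in> (\<lambda>v. [v]) ` space_n N" unfolding v by (rule imageI)
next
  fix vs assume "vs \<in> (\<lambda>v. [v]) ` space_n N"
  then obtain v where "vs = [v]" "v \<in> space_n N" by (rule imageE)
  then show "vs \<in> vlists N 1" by (simp add: vlists_def)
qed

lemma alternating_linear:
  assumes "\<And>v. v \<in> space_n 3 \<Longrightarrow> a [v] = c0 * v 0 + c1 * v 1 + c2 * v 2"
  shows "alternating_form 3 1 a"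
proof -
  have "a ([w][i := lincomb 3 c u d v]) = c * a ([w][i := u]) + d * a ([w][i := v])"
    if "u \<in> space_n 3" "v \<in> space_n 3" "i < 1" for w u v c d i
  proof -
    have "lincomb 3 c u d v \<in> space_n 3" by (simp add: lincomb_def)
    then show ?thesis using that by (simp add: assms) (simp add: lincomb_def algebra_simps)
  qed
  then show ?thesis unfolding alternating_form_def vlists_1 by auto
qed

lemma smooth_form_eta: "smooth_form heis big_cube 1 eta"
  unfolding smooth_form_def heis_simps
proof (intro conjI ballI)
  show "alternating_form 3 1 (eta x)" for x
    by (rule alternating_linear[of _ 0 0 "bump x"]) (simp add: eta_def)
  fix vs :: "pt list"
  have "(\<lambda>x. bump x * (hd vs) 2) \<in> smooth_alg 3"
    by (intro smooth_alg.mult bump_smooth_alg smooth_alg.const)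
  then show "smooth_on 3 big_cube (\<lambda>x. eta x vs)"
    unfolding eta_def by (rule smooth_alg_smooth_on)
qed

lemma compactly_supported_eta: "compactly_supported_form heis big_cube 1 eta"
  unfolding compactly_supported_form_def heis_simps
proof (intro exI conjI ballI)
  fix x vs assume "x \<in> big_cube - closed_cube"
  then have "bump x = 0" using cube_space bump_outside by blast
  then show "eta x vs = 0" by (simp add: eta_def)
qed (rule compactin_closed_cube, rule closed_cube_subset)

lemma continuous_form_omega: "continuous_form heis (space_n 3) 1 omega"
  unfolding continuous_form_def heis_simps
proof (intro conjI ballI)
  show "alternating_form 3 1 (omega x)" for x
    by (rule alternating_linear[of _ "1 - x 1 / 2" "x 0 / 2" 1]) (simp add: omega_def field_simps)
  fix vs :: "pt list"
  have "(\<lambda>x. hd vs 0 + hd vs 2 + (1 / 2) * (x 0 * hd vs 1 + (- hd vs 0) * x 1)) \<in> smooth_alg 3"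
    by (intro smooth_alg.intros(1,3,4) smooth_alg_coord) auto
  then have "(\<lambda>x. omega x vs) \<in> smooth_alg 3" by (simp add: omega_def field_simps)
  from smooth_alg_continuous[OF this]
  show "continuous_map (subtopology (top_n 3) (space_n 3)) euclideanreal (\<lambda>x. omega x vs)"
    by (rule continuous_map_from_subtopology)
qed

definition null_integral :: "nat \<Rightarrow> (pt \<Rightarrow> real) \<Rightarrow> bool" where
  "null_integral N F \<longleftrightarrow> tame N F \<and> (\<integral>x. F x \<partial>lborel_n N) = 0"

lemma null_integral_add: "null_integral N F \<Longrightarrow> null_integral N G \<Longrightarrow> null_integral N (\<lambda>x. F x + G x)"
  unfolding null_integral_def using tame_add tame_integrable[of N F] tame_integrable[of N G] by auto

lemma null_integral_cmult: "null_integral N F \<Longrightarrow> null_integral N (\<lambda>x. c * F x)"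
  unfolding null_integral_def using tame_cmult by auto

text \<open>
  Total derivatives of compactly supported functions integrate to zero. The second statement is
  \<open>\<partial>\<^sub>i (x\<^sub>i \<psi>)\<close>, the third \<open>\<partial>\<^sub>i (x\<^sub>j \<psi>)\<close>.
\<close>

lemma null_integral_divergence:
  assumes i: "i < N" and t: "tame N \<psi>" "tame N \<psi>'"
    and d: "\<And>x. x \<in> space_n N \<Longrightarrow> ((\<lambda>t. \<psi> (x(i := t))) has_real_derivative \<psi>' x) (at (x i))"
  shows "null_integral N \<psi>'" and "null_integral N (\<lambda>x. x i * \<psi>' x + \<psi> x)"
    and "j < N \<Longrightarrow> j \<noteq> i \<Longrightarrow> null_integral N (\<lambda>x. x j * \<psi>' x)"
proof -
  show "null_integral N \<psi>'"
    using integration_by_parts_coord[OF has_density_const[of 1] i t d] t by (simp add: null_integral_def)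
  have "tame N (\<lambda>x. x i * \<psi>' x)" by (rule tame_coord[OF t(2) i])
  then show "null_integral N (\<lambda>x. x i * \<psi>' x + \<psi> x)"
    using integration_by_parts_coord[OF has_density_ident i t d] t tame_integrable
    by (simp add: null_integral_def tame_add)
  assume j: "j < N" "j \<noteq> i"
  have tj: "tame N (\<lambda>x. x j * \<psi> x)" "tame N (\<lambda>x. x j * \<psi>' x)"
    using tame_coord[OF t(1) j(1)] tame_coord[OF t(2) j(1)] .
  have "((\<lambda>t. (x(i := t)) j * \<psi> (x(i := t))) has_real_derivative x j * \<psi>' x) (at (x i))" if "x \<in> space_n N" for x
    using DERIV_cmult[OF d[OF that], of "x j"] j by simp
  from integration_by_parts_coord[OF has_density_const[of 1] i tj this] tj
  show "null_integral N (\<lambda>x. x j * \<psi>' x)" by (simp add: null_integral_def)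
qed

lemma unit_vec_simps [simp]: "unit_vec 3 i \<in> space_n 3" 
  "i < 3 \<Longrightarrow> j < 3 \<Longrightarrow> unit_vec 3 i j = (if j = i then 1 else 0)"
  by (auto simp: unit_vec_def)

lemma form_integral_heis: "form_integral heis U \<beta> = (LINT x:U|leb_n 3. \<beta> x [unit_vec 3 0, unit_vec 3 1, unit_vec 3 2])"
proof -
  have "[0..<3] = [0, 1, 2 :: nat]" by (simp add: upt_rec)
  then show ?thesis by (simp add: form_integral_def)
qed

text \<open>
  Expanding \<open>\<omega> \<and> d\<phi>\<close> in coordinates and collecting terms leaves a sum of total derivatives;
  the zeroth-order term \<open>- c\<close> coming from \<open>[X,Y] = T\<close> splits evenly between \<open>\<partial>\<^sub>0 (x\<^sub>0 c)\<close> and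
  \<open>\<partial>\<^sub>1 (x\<^sub>1 c)\<close>.
\<close>

lemma closed_form_omega: "closed_form heis (space_n 3) 1 omega"
  unfolding closed_form_def
proof (intro allI impI, elim conjE)
  fix l :: nat and \<phi> :: "pt \<Rightarrow> covector"
  assume "1 + l + 1 = gdim heis" and s: "smooth_form heis (space_n 3) l \<phi>"
    and c: "compactly_supported_form heis (space_n 3) l \<phi>"
  then have l: "l = 1" by simp
  have U: "openin (top_n 3) (space_n 3)" using openin_topspace[of "top_n 3"] by simp
  let ?U = "space_n 3"
  obtain K where K: "compactin (top_n 3) K" "K \<subseteq> ?U" and K0: "\<forall>x\<in>?U - K. \<forall>vs\<in>vlists 3 1. \<phi> x vs = 0"
    using c unfolding compactly_supported_form_def l heis_simps by blast
  have e: "[unit_vec 3 i] \<in> vlists 3 1" for i by (simp add: vlists_def)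
  have s1: "smooth_form heis ?U 1 \<phi>" using s l by simp
  define q where "q = (\<lambda>i x. \<phi> x [unit_vec 3 i])"
  have sm: "smooth_on 3 ?U (q i)" for i
    using s1 e unfolding smooth_form_def q_def by simp
  have q0: "q i x = 0" if "x \<in> ?U - K" for i x using bspec[OF bspec[OF K0 that] e] by (simp add: q_def)
  let ?q = "\<lambda>i x. indicator ?U x * q i x" and ?d = "\<lambda>k i x. indicator ?U x * partial k (q i) x"
  have n: "null_integral 3 (?d k i)" "null_integral 3 (\<lambda>x. x k * ?d k i x + ?q i x)"
    "j < 3 \<Longrightarrow> j \<noteq> k \<Longrightarrow> null_integral 3 (\<lambda>x. x j * ?d k i x)" if "k < 3" for j k i
  proof -
    note sc = smooth_compact_support[OF U sm K(1) K(2) q0 that]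
    have a: "tame 3 (?q i)" "tame 3 (?d k i)" 
      "\<And>x. x \<in> ?U \<Longrightarrow> ((\<lambda>t. ?q i (x(k := t))) has_real_derivative ?d k i x) (at (x k))"
      using sc by blast+
    show "null_integral 3 (?d k i)" "null_integral 3 (\<lambda>x. x k * ?d k i x + ?q i x)"
      "j < 3 \<Longrightarrow> j \<noteq> k \<Longrightarrow> null_integral 3 (\<lambda>x. x j * ?d k i x)"
      using null_integral_divergence[OF that a] by blast+
  qed
  \<comment> \<open>\<open>?d k i\<close> is \<open>\<partial>\<^sub>k\<close> of the \<open>i\<close>-th component of \<open>\<phi>\<close>; every summand is a total derivative.\<close>
  let ?F = "\<lambda>x. ?d 0 1 x + ((-1) * ?d 1 0 x + (?d 1 2 x + ((1/2) * (x 0 * ?d 2 2 x) + ((-1) * ?d 2 1 x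
     + ((-1/2) * (x 1 * ?d 1 2 x + ?q 2 x) + (-1/2) * (x 0 * ?d 0 2 x + ?q 2 x))))))"
  have F: "null_integral 3 ?F"
    by (intro null_integral_add null_integral_cmult n) auto
  have "form_integral heis ?U (\<lambda>x. wedge 1 (1 + 1) (omega x) (ext_deriv heis 1 \<phi> x)) = (\<integral>x. ?F x \<partial>lborel_n 3)"
    unfolding form_integral_heis
  proof (rule set_integral_leb_n)
    show "tame 3 ?F" using F by (simp add: null_integral_def)
    fix x assume x: "x \<in> ?U"
    note E = ext_deriv_1_heis[OF U s1 x]
    have qq: "(\<lambda>y. \<phi> y [unit_vec 3 i]) = q i" "\<phi> x [unit_vec 3 i] = q i x" for i
      by (simp_all add: q_def)
    have "wedge 1 2 (omega x) (ext_deriv heis 1 \<phi> x) [unit_vec 3 0, unit_vec 3 1, unit_vec 3 2] = ?F x"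
      unfolding wedge_1_2[of "ext_deriv heis 1 \<phi> x", OF E(4-6)] E(1-3) qq omega_def
      using x by (simp add: field_simps)
    then show "indicator ?U x * wedge 1 (1 + 1) (omega x) (ext_deriv heis 1 \<phi> x) [unit_vec 3 0, unit_vec 3 1, unit_vec 3 2] = ?F x"
      unfolding one_add_one using x by simp
  qed
  then show "form_integral heis ?U (\<lambda>x. wedge 1 (l + 1) (omega x) (ext_deriv heis l \<phi> x)) = 0"
    using F by (simp add: null_integral_def l)
qed

lemma finite_component_weights:
  "finite {sum_list (map (layer G) js) | js. set js \<subseteq> {..<gdim G} \<and> length js = k}"
proof -
  have "finite {js. set js \<subseteq> {..<gdim G} \<and> length js = k}" by (rule finite_lists_length_eq) simp
  then have "finite ((\<lambda>js. sum_list (map (layer G) js)) ` {js. set js \<subseteq> {..<gdim G} \<and> length js = k})" by simp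
  moreover have "(\<lambda>js. sum_list (map (layer G) js)) ` {js. set js \<subseteq> {..<gdim G} \<and> length js = k}
    = {sum_list (map (layer G) js) | js. set js \<subseteq> {..<gdim G} \<and> length js = k}" by blast
  ultimately show ?thesis by simp
qed

lemma covector_wt_ge:
  assumes "set js \<subseteq> {..<gdim G}" "length js = k" "a (map (unit_vec (gdim G)) js) \<noteq> 0"
  shows "sum_list (map (layer G) js) \<le> covector_wt G k a"
  unfolding covector_wt_def
proof (rule Max_ge)
  show "finite (component_weights G k a)"
    by (rule finite_subset[OF _ finite_component_weights[of G k]]) (auto simp: component_weights_def)
  show "sum_list (map (layer G) js) \<in> component_weights G k a"
    using assms unfolding component_weights_def by blast
qed

text \<open>
  The summand \<open>Max {}\<close> covers the covectors without nonzero components. A bound is what makes the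
  least number in the definition of the weight of a form exist.
\<close>

lemma covector_wt_bounded: "\<exists>m. \<forall>a. covector_wt G k a \<le> m"
proof -
  let ?S = "{sum_list (map (layer G) js) | js. set js \<subseteq> {..<gdim G} \<and> length js = k}"
  have "covector_wt G k a \<le> Max ?S + Max {}" for a
  proof (cases "component_weights G k a = {}")
    case True
    then show ?thesis by (simp add: covector_wt_def)
  next
    case False
    have "Max (component_weights G k a) \<le> Max ?S"
      by (rule Max_mono[OF _ False finite_component_weights]) (auto simp: component_weights_def)
    then show ?thesis by (simp add: covector_wt_def)
  qed
  then show ?thesis by blast
qed

text \<open>
  The essential supremum is attained: the least admissible bound is itself admissible.
\<close>

lemma form_wt_AE:
  "AE x in leb_n (gdim G). x \<in> U \<and> (\<exists>vs\<in>vlists (gdim G) k. \<alpha> x vs \<noteq> 0) \<longrightarrow> covector_wt G k (\<alpha> x) \<le> form_wt G U k \<alpha>"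
proof -
  obtain m where "\<forall>a. covector_wt G k a \<le> m" using covector_wt_bounded by blast
  then have "AE x in leb_n (gdim G). x \<in> U \<and> (\<exists>vs\<in>vlists (gdim G) k. \<alpha> x vs \<noteq> 0) \<longrightarrow> covector_wt G k (\<alpha> x) \<le> m"
    by simp
  then show ?thesis unfolding form_wt_def by (rule LeastI)
qed

lemma form_wt_omega: "form_wt heis (space_n 3) 1 omega \<ge> 2"
proof (rule ccontr)
  assume lt: "\<not> form_wt heis (space_n 3) 1 omega \<ge> 2"
  have "AE x in leb_n 3. False"
    using form_wt_AE[where G=heis and U="space_n 3" and k=1 and \<alpha>=omega] unfolding heis_simps(2)
  proof (rule AE_mp, intro AE_I2 impI)
    fix x assume "x \<in> space (leb_n 3)" and
      a: "x \<in> space_n 3 \<and> (\<exists>vs\<in>vlists 3 1. omega x vs \<noteq> 0) \<longrightarrow> covector_wt heis 1 (omega x) \<le> form_wt heis (space_n 3) 1 omega"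
    then have x: "x \<in> space_n 3" by (simp add: space_leb_n)
    have w: "omega x [unit_vec 3 2] \<noteq> 0" by (simp add: omega_def)
    then have "2 \<le> covector_wt heis 1 (omega x)"
      using covector_wt_ge[of "[2]" heis 1 "omega x"] by simp
    moreover have "[unit_vec 3 2] \<in> vlists 3 1" by (simp add: vlists_def)
    ultimately show False using a x w lt by fastforce
  qed
  then have "AE x in lborel_n 3. False" unfolding leb_n_def by (simp add: AE_completion_iff)
  then have "AE x in lborel_n 3. x \<notin> cube 0 1" by (rule eventually_mono) simp
  then show False using cube_not_null[of 0 1] by simp
qed

abbreviation integrand :: "pt \<Rightarrow> real" where
  "integrand x \<equiv> wedge 1 2 (pansu_pullback heis heis height_map omega x) (ext_deriv heis 1 eta x)
     [unit_vec 3 0, unit_vec 3 1, unit_vec 3 2]"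

text \<open>
  The first form shows that the integrand sees only the components of \<open>d\<eta>\<close> of weight \<open>3\<close>; in the
  second the terms with \<open>\<partial>\<^sub>2\<close> have cancelled.
\<close>

lemma integrand_eq:
  assumes "x \<in> big_cube"
  shows "integrand x = - (x 1 / 2) * ext_deriv heis 1 eta x [unit_vec 3 1, unit_vec 3 2]
           - (x 0 / 2) * ext_deriv heis 1 eta x [unit_vec 3 0, unit_vec 3 2]"
    and "integrand x = - (1 / 2) * (x 1 * partial 1 bump x + x 0 * partial 0 bump x)"
proof -
  have xs: "x \<in> space_n 3" using assms cube_space by blast
  note E = ext_deriv_1_heis[OF open_cube smooth_form_eta assms]
  have p: "pansu_pullback heis heis height_map omega x [unit_vec 3 i]
     = (x 0 * unit_vec 3 i 1 - x 1 * unit_vec 3 i 0) / 2" for i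
    by (simp add: pansu_pullback_def pansu_derivative_height[OF xs] omega_def height_map_def pansu_height_def)
  show 1: "integrand x = - (x 1 / 2) * ext_deriv heis 1 eta x [unit_vec 3 1, unit_vec 3 2]
           - (x 0 / 2) * ext_deriv heis 1 eta x [unit_vec 3 0, unit_vec 3 2]"
    unfolding wedge_1_2[of "ext_deriv heis 1 eta x", OF E(4-6)] p by simp
  have z: "partial i (\<lambda>x. 0) x = 0" for i x by (simp add: partial_def)
  have eta: "(\<lambda>y. eta y [unit_vec 3 0]) = (\<lambda>_. 0)" "(\<lambda>y. eta y [unit_vec 3 1]) = (\<lambda>_. 0)"
    "(\<lambda>y. eta y [unit_vec 3 2]) = bump" by (simp_all add: eta_def fun_eq_iff)
  show "integrand x = - (1 / 2) * (x 1 * partial 1 bump x + x 0 * partial 0 bump x)"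
    unfolding 1 E(2,3) eta z by (simp add: algebra_simps)
qed

lemma bump_tame:
  "tame 3 (\<lambda>x. indicator big_cube x * bump x)"
  "i < 3 \<Longrightarrow> tame 3 (\<lambda>x. indicator big_cube x * partial i bump x)"
  "i < 3 \<Longrightarrow> x \<in> space_n 3 \<Longrightarrow> ((\<lambda>t. indicator big_cube (x(i := t)) * bump (x(i := t))) has_real_derivative
           indicator big_cube x * partial i bump x) (at (x i))"
proof -
  have b: "bump x = 0" if "x \<in> big_cube - closed_cube" for x using that cube_space bump_outside by blast
  note sc = smooth_compact_support[OF open_cube smooth_alg_smooth_on[OF bump_smooth_alg] compactin_closed_cube closed_cube_subset b]
  show "tame 3 (\<lambda>x. indicator big_cube x * bump x)" by (rule sc(1)[of 0]) simp_all
  show "i < 3 \<Longrightarrow> tame 3 (\<lambda>x. indicator big_cube x * partial i bump x)" by (rule sc(2))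
  show "i < 3 \<Longrightarrow> x \<in> space_n 3 \<Longrightarrow> ((\<lambda>t. indicator big_cube (x(i := t)) * bump (x(i := t))) has_real_derivative
           indicator big_cube x * partial i bump x) (at (x i))" by (rule sc(3))
qed

lemma integral_bump_pos: "(\<integral>x. indicator big_cube x * bump x \<partial>lborel_n 3) \<noteq> 0"
proof
  assume "(\<integral>x. indicator big_cube x * bump x \<partial>lborel_n 3) = 0"
  then have "AE x in lborel_n 3. indicator big_cube x * bump x = 0"
    using integral_nonneg_eq_0_iff_AE[OF tame_integrable[OF bump_tame(1)]] bump_nonneg by simp
  then have "AE x in lborel_n 3. x \<notin> cube 0 1"
  proof eventually_elim
    case (elim x)
    show ?case
    proof
      assume x: "x \<in> cube 0 1"
      have "cube 0 1 \<subseteq> big_cube" unfolding cube_def by (rule PiE_mono) auto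
      with x have "x \<in> big_cube" by blast
      moreover have "bump x \<noteq> 0"
        using cube_bounds[OF x, of 0] cube_bounds[OF x, of 1] cube_bounds[OF x, of 2]
        by (simp add: bump_def bump1_pos_iff)
      ultimately show False using elim by simp
    qed
  qed
  then show False using cube_not_null[of 0 1] by simp
qed

text \<open>
  Since \<open>x\<^sub>i \<partial>\<^sub>i h = \<partial>\<^sub>i (x\<^sub>i h) - h\<close>, the integral of
  \<open>- (x\<^sub>1 \<partial>\<^sub>1 h + x\<^sub>0 \<partial>\<^sub>0 h)/2\<close> is that of \<open>h\<close>.
\<close>

lemma form_integral_integrand: "(LINT x:big_cube|leb_n 3. integrand x) \<noteq> 0"
proof -
  let ?b = "\<lambda>x. indicator big_cube x * bump x" and ?d = "\<lambda>i x. indicator big_cube x * partial i bump x"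
  have n: "null_integral 3 (\<lambda>x. x i * ?d i x + ?b x)" if "i < 3" for i
    by (rule null_integral_divergence(2)[OF that bump_tame(1) bump_tame(2)[OF that] bump_tame(3)[OF that]])
  let ?N = "\<lambda>x. (- 1 / 2) * ((x 1 * ?d 1 x + ?b x) + (x 0 * ?d 0 x + ?b x))"
  have N: "null_integral 3 ?N"
    by (intro null_integral_cmult null_integral_add n) auto
  have "(LINT x:big_cube|leb_n 3. integrand x) = (\<integral>x. ?N x + ?b x \<partial>lborel_n 3)"
  proof (rule set_integral_leb_n)
    show "tame 3 (\<lambda>x. ?N x + ?b x)" using N bump_tame(1) by (intro tame_add) (simp_all add: null_integral_def)
    fix x
    show "indicator big_cube x * integrand x = ?N x + ?b x"
      using integrand_eq(2)[of x] by (cases "x \<in> big_cube") (simp_all add: algebra_simps)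
  qed
  also have "\<dots> = (\<integral>x. ?b x \<partial>lborel_n 3)"
    using N tame_integrable[of 3 ?N] tame_integrable[OF bump_tame(1)] by (simp add: null_integral_def)
  finally show ?thesis using integral_bump_pos by simp
qed

text \<open>
  If almost everywhere \<open>d\<eta>\<close> had weight at most \<open>2\<close>, its components of weight \<open>3\<close> would vanish,
  and with them the integrand, whose integral is not zero.
\<close>

lemma form_wt_d_eta: "form_wt heis big_cube 2 (ext_deriv heis 1 eta) \<ge> 3"
proof (rule ccontr)
  assume lt: "\<not> form_wt heis big_cube 2 (ext_deriv heis 1 eta) \<ge> 3"
  have "AE x in leb_n 3. indicator big_cube x *\<^sub>R integrand x = 0"
    using form_wt_AE[where G=heis and U=big_cube and k=2 and \<alpha>="ext_deriv heis 1 eta"] unfolding heis_simps(2)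
  proof eventually_elim
    case (elim x)
    show ?case
    proof (cases "x \<in> big_cube")
      case True
      have "ext_deriv heis 1 eta x [unit_vec 3 i, unit_vec 3 2] = 0" if i: "i < 2" for i
      proof (rule ccontr)
        assume nz: "ext_deriv heis 1 eta x [unit_vec 3 i, unit_vec 3 2] \<noteq> 0"
        have "3 \<le> covector_wt heis 2 (ext_deriv heis 1 eta x)"
          using covector_wt_ge[of "[i, 2]" heis 2 "ext_deriv heis 1 eta x"] nz i by simp
        moreover have "[unit_vec 3 i, unit_vec 3 2] \<in> vlists 3 2" by (simp add: vlists_def)
        ultimately show False using elim True nz lt by fastforce
      qed
      then show ?thesis using integrand_eq(1)[OF True] by simp
    qed simp
  qed
  then have "(LINT x:big_cube|leb_n 3. integrand x) = 0"
    unfolding set_lebesgue_integral_def by (rule integral_eq_zero_AE)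
  then show False using form_integral_integrand by simp
qed

theorem theorem5p1:
  shows "\<exists>(G1 :: carnot) (G2 :: carnot) (U :: pt set) (U' :: pt set) (f :: pt \<Rightarrow> pt) (p :: real)
            (k :: nat) (l :: nat) (\<omega> :: pt \<Rightarrow> covector) (\<eta> :: pt \<Rightarrow> covector).
     carnot_group G1 \<and> carnot_group G2 \<and>
     open_domain (gdim G1) U \<and> openin (top_n (gdim G2)) U' \<and> f ` U \<subseteq> U' \<and>
     sobolev_map p G1 U G2 f \<and> pansu_differentiable_ae G1 U G2 f \<and>
     k + l + 1 = gdim G1 \<and>
     continuous_form G2 U' k \<omega> \<and> closed_form G2 U' k \<omega> \<and>
     smooth_form G1 U l \<eta> \<and> compactly_supported_form G1 U l \<eta> \<and>
     p > max (real (form_wt G2 U' k \<omega>)) (real (step G2) + 1) \<and>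
     \<not> (form_wt G2 U' k \<omega> + form_wt G1 U (l + 1) (ext_deriv G1 l \<eta>) \<le> hom_dim G1) \<and>
     form_integral G1 U
       (\<lambda>x. wedge k (l + 1) (pansu_pullback G1 G2 f \<omega> x) (ext_deriv G1 l \<eta> x)) \<noteq> 0"
proof -
  define p where "p = max (real (form_wt heis (space_n 3) 1 omega)) (real (step heis) + 1) + 1"
  have p: "p > max (real (form_wt heis (space_n 3) 1 omega)) (real (step heis) + 1)" "p \<ge> 0"
    by (auto simp: p_def)
  have "openin (top_n 3) (space_n 3)" using openin_topspace[of "top_n 3"] by simp
  moreover have "height_map ` big_cube \<subseteq> space_n 3"
    unfolding height_map_def by (intro image_subsetI xline_simps)
  moreover have "\<not> (form_wt heis (space_n 3) 1 omega + form_wt heis big_cube (1 + 1) (ext_deriv heis 1 eta) \<le> hom_dim heis)"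
    unfolding one_add_one using form_wt_omega form_wt_d_eta by (simp add: hom_dim_heis)
  moreover have "form_integral heis big_cube
       (\<lambda>x. wedge 1 (1 + 1) (pansu_pullback heis heis height_map omega x) (ext_deriv heis 1 eta x)) \<noteq> 0"
    unfolding one_add_one form_integral_heis by (rule form_integral_integrand)
  ultimately show ?thesis
    using carnot_group_heis open_domain_cube[of "-1" 2] sobolev_height_map[OF p(2)] pansu_differentiable_height
      continuous_form_omega closed_form_omega smooth_form_eta compactly_supported_eta p(1)
    by (intro exI[of _ heis] exI[of _ big_cube] exI[of _ "space_n 3"] exI[of _ height_map] exI[of _ p]
        exI[of _ "1::nat"] exI[of _ omega] exI[of _ eta] conjI) simp_all
qed

end
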